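(* Let $U \subseteq \mathbb{R}^n$ be open, $m \in \mathbb{N}$, and let $g_1,\ldots,g_m \colon U \to \mathbb{R}$ be continuous and $C^{1,1}$-submersions on their zero sets. Assume that the set $$\Omega = \{ x \in U \mid g_1(x) \leq 0,\ldots, g_m(x) \leq 0\}$$ is closed in $\mathbb{R}^n$ and connected. For $x \in \Omega$ let $\mathcal{A}(x)=\{ i \in \{1,\ldots,m\} \mid g_i(x) =0\}$ and $\mathcal{C}(x)=\{ h \in \mathbb{R}^n \mid g'_j(x) h \leq 0 \text{ for all } j \in \mathcal{A}(x)\}$. (i) $\Omega$ is convex if for every $x \in \partial \Omega$ the interior of $\mathcal{C}(x)$ is non-empty and there exists $i \in \mathcal{A}(x)$ such that $$\liminf_{t \to 0,\, t>0} \frac{g_i'(x+th)h}{t} \geq 0 \qquad ( * )$$ whenever $h \in \mathcal{C}(x) \cap \ker g_i'(x)$. (ii) If $\Omega$ is convex, $x \in \partial \Omega$, and the derivatives $g_i'(x)$, $i \in \mathcal{A}(x)$, are linearly independent, then $( * )$ holds for every $i \in \mathcal{A}(x)$ and all $h \in \mathcal{C}(x) \cap \ker g_i'(x)$.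
   Context: $\mathbb{R}^n$ carries the Euclidean inner product and norm; $\partial\Omega$ is the boundary of $\Omega$ in $\mathbb{R}^n$; $\mathbb{N}=\{1,2,\ldots\}$. A map is of class $C^{1,1}$ if it is of class $C^1$ and its derivative is Lipschitz continuous. A map $f\colon U \to \mathbb{R}$ on an open set $U \subseteq \mathbb{R}^n$ is a $C^{1,1}$-submersion on its zero set if, for every zero $x$ of $f$, $f$ is of class $C^{1,1}$ on a neighborhood of $x$ and $f'(x)$ is surjective. Convexity is meant in the usual sense. *)

theory Defs
  imports "HOL-Analysis.Analysis"
begin

text \<open>The derivative as an element of the normed space of bounded linear maps, so that continuity,
  Lipschitz continuity and linear independence of derivatives refer to that space.
  It is meaningful only at points where the map is differentiable.\<close>

definition total_deriv ::
  "('a::real_normed_vector \<Rightarrow> 'b::real_normed_vector) \<Rightarrow> 'a \<Rightarrow> 'a \<Rightarrow>\<^sub>L 'b" where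
  "total_deriv f x = Blinfun (frechet_derivative f (at x))"

definition C11_on ::
  "'a::real_normed_vector set \<Rightarrow> ('a \<Rightarrow> 'b::real_normed_vector) \<Rightarrow> bool" where
  "C11_on V f \<longleftrightarrow>
     (\<forall>x\<in>V. f differentiable (at x)) \<and>
     continuous_on V (total_deriv f) \<and>
     (\<exists>L. L-lipschitz_on V (total_deriv f))"

definition C11_submersion_on_zeros ::
  "'a::real_normed_vector set \<Rightarrow> ('a \<Rightarrow> real) \<Rightarrow> bool" where
  "C11_submersion_on_zeros U f \<longleftrightarrow>
     (\<forall>x\<in>U. f x = 0 \<longrightarrow>
        (\<exists>V. open V \<and> x \<in> V \<and> V \<subseteq> U \<and> C11_on V f) \<and>
        surj (blinfun_apply (total_deriv f x)))"

definition feasible_set ::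
  "'a set \<Rightarrow> nat \<Rightarrow> (nat \<Rightarrow> 'a \<Rightarrow> real) \<Rightarrow> 'a set" where
  "feasible_set U m g = {x \<in> U. \<forall>i\<in>{1..m}. g i x \<le> 0}"

definition active_set ::
  "nat \<Rightarrow> (nat \<Rightarrow> 'a \<Rightarrow> real) \<Rightarrow> 'a \<Rightarrow> nat set" where
  "active_set m g x = {i \<in> {1..m}. g i x = 0}"

definition linearized_cone ::
  "nat \<Rightarrow> (nat \<Rightarrow> 'a::real_normed_vector \<Rightarrow> real) \<Rightarrow> 'a \<Rightarrow> 'a set" where
  "linearized_cone m g x =
     {h. \<forall>j\<in>active_set m g x. blinfun_apply (total_deriv (g j) x) h \<le> 0}"

definition deriv_kernel ::
  "('a::real_normed_vector \<Rightarrow> 'b::real_normed_vector) \<Rightarrow> 'a \<Rightarrow> 'a set" where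
  "deriv_kernel f x = {h. blinfun_apply (total_deriv f x) h = 0}"

definition second_order_cond ::
  "('a::real_normed_vector \<Rightarrow> real) \<Rightarrow> 'a \<Rightarrow> 'a \<Rightarrow> bool" where
  "second_order_cond f x h \<longleftrightarrow>
     Liminf (at_right 0)
       (\<lambda>t::real. ereal (blinfun_apply (total_deriv f (x + t *\<^sub>R h)) h / t)) \<ge> 0"

text \<open>Linear independence of a family, not merely of its range: repetitions are excluded.\<close>

definition independent_family ::
  "'i set \<Rightarrow> ('i \<Rightarrow> 'v::real_vector) \<Rightarrow> bool" where
  "independent_family I v \<longleftrightarrow> inj_on v I \<and> independent (v ` I)"

end

theory Submission
  imports Defs
begin

text \<open>
  Let \<open>\<Omega>\<close> be the feasible set and \<open>X\<close> its interior.

  For the first part, the non-emptiness of the interior of the linearized cone at boundary points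
  makes \<open>\<Omega>\<close> locally a region above a graph: a fixed direction leads from \<open>\<Omega>\<close> into
  \<open>X\<close> (\<open>feasible_push\<close>). Because \<open>\<Omega>\<close> is connected, its convexity then follows once the
  relation ``the segment from \<open>a\<close> to \<open>b\<close> lies in \<open>X\<close>'' is known to be transitive
  (\<open>convex_if_interior_segments_transitive\<close>). If transitivity fails, some boundary point \<open>z\<close> is
  touched by an arc \<open>z + t h - t\<^sup>2 u\<close> in \<open>X\<close> that bends outwards
  (\<open>concave_touching_point\<close>), and a ball in \<open>X\<close> touches the boundary at \<open>z\<close>. The arc forces the
  derivatives of all active constraints to vanish on \<open>h\<close>, and the ball forces them to be negative
  on \<open>u\<close>. So \<open>z + t h\<close>, which lies \<open>t\<^sup>2 u\<close> further than a feasible point, satisfies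
  \<open>g i (z + t h) \<le> - c t\<^sup>2\<close> for every active \<open>i\<close>, whereas the second order condition for one
  active \<open>i\<close> yields \<open>g i (z + t h) \<ge> - o(t\<^sup>2)\<close>.

  For the second part, linear independence allows one to correct \<open>x + t h\<close> by a vector of size
  \<open>O(t\<^sup>2)\<close> to a feasible point \<open>y\<close> with \<open>g i y = 0\<close>. The hyperplanes supporting the convex set
  \<open>\<Omega>\<close> at \<open>x\<close> and at \<open>y\<close> bound \<open>g i' (x + t h) h / t\<close> from below by \<open>- O(t)\<close>
  (\<open>slope_bound_from_supporting\<close>). Here Lipschitz continuity is essential, as the derivative has
  to be compared at points of distance \<open>O(t\<^sup>2)\<close> with an error that is \<open>o(t)\<close>.
\<close>

section \<open>Derivatives along lines\<close>

lemma has_derivative_total_deriv: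
  fixes f :: "'a::real_normed_vector \<Rightarrow> 'b::real_normed_vector"
  assumes "f differentiable (at x)"
  shows "(f has_derivative blinfun_apply (total_deriv f x)) (at x)"
  using assms frechet_derivative_works[of f "at x"]
  by (simp add: total_deriv_def bounded_linear_Blinfun_apply has_derivative_bounded_linear)

lemma has_real_derivative_along_line:
  fixes f :: "'a::real_normed_vector \<Rightarrow> real"
  assumes "f differentiable (at (x + t *\<^sub>R v))"
  shows "((\<lambda>s. f (x + s *\<^sub>R v)) has_real_derivative total_deriv f (x + t *\<^sub>R v) v) (at t)"
proof -
  have "((\<lambda>s. x + s *\<^sub>R v) has_derivative (\<lambda>s. s *\<^sub>R v)) (at t)"
    by (auto intro!: derivative_eq_intros)
  from has_derivative_compose[OF this has_derivative_total_deriv[OF assms]]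
  show ?thesis
    by (rule has_derivative_imp_has_field_derivative) (simp add: blinfun.scaleR_right mult.commute)
qed

lemma total_deriv_nonpos_if_nonincreasing:
  fixes f :: "'a::real_normed_vector \<Rightarrow> real"
  assumes diff: "f differentiable (at x)"
    and le: "\<forall>\<^sub>F t in at_right 0. f (x + t *\<^sub>R v) \<le> f x"
  shows "total_deriv f x v \<le> 0"
proof (rule ccontr)
  assume "\<not> total_deriv f x v \<le> 0"
  then have pos: "total_deriv f x v > 0"
    by simp
  have "((\<lambda>s. f (x + s *\<^sub>R v)) has_real_derivative total_deriv f x v) (at 0)"
    using has_real_derivative_along_line[of f x 0 v] diff by simp
  from DERIV_pos_inc_right[OF this pos] obtain d
    where d: "d > 0" "\<And>h. h > 0 \<Longrightarrow> h < d \<Longrightarrow> f x < f (x + h *\<^sub>R v)"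
    by auto
  have "\<forall>\<^sub>F t in at_right 0. t < d \<and> (0::real) < t"
    using d(1) by (auto simp: eventually_at_right)
  with le have "\<forall>\<^sub>F t in at_right (0::real). False"
    by eventually_elim (use d(2) in force)
  then show False
    by simp
qed

text \<open>A nonzero functional is open, hence it cannot attain the value zero at an interior point of
  a set on which it is nonpositive.\<close>

lemma functional_neg_on_interior:
  fixes \<phi> :: "'a::real_normed_vector \<Rightarrow>\<^sub>L real"
  assumes surj: "surj (blinfun_apply \<phi>)" and v: "v \<in> interior {h. \<phi> h \<le> 0}"
  shows "\<phi> v < 0"
proof -
  obtain k where k: "\<phi> k = 1"
    using surj by (metis surjD)
  obtain e where e: "e > 0" "ball v e \<subseteq> {h. \<phi> h \<le> 0}"
    using v by (meson mem_interior)
  define s where "s = e / 2 / (norm k + 1)"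
  have s: "s > 0"
    using e(1) by (simp add: s_def add_nonneg_pos)
  have "s * norm k < e"
  proof -
    have "norm k + 1 > 0"
      by (simp add: add_nonneg_pos)
    then have "s * (norm k + 1) = e / 2"
      unfolding s_def by (metis less_numeral_extra(3) nonzero_eq_divide_eq)
    then show ?thesis
      using s e(1) by (simp add: algebra_simps)
  qed
  then have "v + s *\<^sub>R k \<in> ball v e"
    using s by (simp add: dist_norm)
  then have "\<phi> v + s * \<phi> k \<le> 0"
    using e(2) by (auto simp: blinfun.add_right blinfun.scaleR_right)
  then show ?thesis
    using k s by simp
qed

text \<open>The second order condition bounds the slope of \<open>t \<mapsto> f (z + t h)\<close> from below by
  \<open>- c t\<close> for small \<open>t > 0\<close>, whatever \<open>c > 0\<close>. Integration would give
  \<open>- c t\<^sup>2 / 2\<close>; the factor is dropped because \<open>c\<close> is arbitrary.\<close>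

lemma second_order_cond_lower_bound:
  fixes f :: "'a::real_normed_vector \<Rightarrow> real"
  assumes V: "open V" "z \<in> V" "\<And>y. y \<in> V \<Longrightarrow> f differentiable (at y)"
    and soc: "second_order_cond f z h" and c: "c > 0"
  shows "\<forall>\<^sub>F t in at_right 0. f z - c * t\<^sup>2 \<le> f (z + t *\<^sub>R h)"
proof -
  have "ereal (- c) < 0"
    using c by simp
  then have "ereal (- c) < Liminf (at_right 0) (\<lambda>t. ereal (total_deriv f (z + t *\<^sub>R h) h / t))"
    using soc unfolding second_order_cond_def by (rule less_le_trans)
  then have ev1: "\<forall>\<^sub>F t in at_right 0. - c < total_deriv f (z + t *\<^sub>R h) h / t"
    by (auto dest!: less_LiminfD)
  have "((\<lambda>t. z + t *\<^sub>R h) \<longlongrightarrow> z + 0 *\<^sub>R h) (at_right (0::real))"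
    by (intro tendsto_intros)
  then have ev2: "\<forall>\<^sub>F t in at_right (0::real). z + t *\<^sub>R h \<in> V"
    using V(1,2) by (simp add: topological_tendstoD)
  obtain d where d: "d > 0"
    "\<And>t. 0 < t \<Longrightarrow> t < d \<Longrightarrow> - c < total_deriv f (z + t *\<^sub>R h) h / t \<and> z + t *\<^sub>R h \<in> V"
    using eventually_conj[OF ev1 ev2] unfolding eventually_at_right_field by auto
  have "f z - c * t\<^sup>2 \<le> f (z + t *\<^sub>R h)" if t: "0 < t" "t < d" for t
  proof -
    have der: "((\<lambda>s. f (z + s *\<^sub>R h) + c * s\<^sup>2) has_real_derivative
                 total_deriv f (z + s *\<^sub>R h) h + 2 * c * s) (at s)" if "0 \<le> s" "s \<le> t" for s
    proof -
      have "z + s *\<^sub>R h \<in> V"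
        using d(2)[of s] that t V(2) by (cases "s = 0") auto
      from has_real_derivative_along_line[OF V(3)[OF this]] show ?thesis
        by (auto intro!: derivative_eq_intros)
    qed
    have "f (z + 0 *\<^sub>R h) + c * 0\<^sup>2 < f (z + t *\<^sub>R h) + c * t\<^sup>2"
    proof (rule DERIV_pos_imp_increasing_open[OF t(1)])
      fix s assume s: "0 < s" "s < t"
      have "- c * s < total_deriv f (z + s *\<^sub>R h) h"
        using d(2)[of s] s t by (simp add: field_simps)
      moreover have "c * s > 0"
        using c s by simp
      ultimately have "total_deriv f (z + s *\<^sub>R h) h + 2 * c * s > 0"
        by (simp add: algebra_simps)
      then show "\<exists>y. ((\<lambda>s. f (z + s *\<^sub>R h) + c * s\<^sup>2) has_real_derivative y) (at s) \<and> 0 < y"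
        using der[of s] s by auto
    next
      show "continuous_on {0..t} (\<lambda>s. f (z + s *\<^sub>R h) + c * s\<^sup>2)"
        by (rule DERIV_continuous_on)
          (use der in \<open>auto intro: has_field_derivative_at_within\<close>)
    qed
    then show ?thesis
      by simp
  qed
  with d(1) show ?thesis
    unfolding eventually_at_right_field by blast
qed

lemma total_deriv_nbhd:
  fixes f :: "'a::real_normed_vector \<Rightarrow> real"
  assumes "open V" "x \<in> V" "continuous_on V (total_deriv f)" "total_deriv f x v < c"
  obtains r where "r > 0" "ball x r \<subseteq> V" "\<And>y. y \<in> ball x r \<Longrightarrow> total_deriv f y v < c"
proof -
  have "continuous_on V (\<lambda>y. total_deriv f y v)"
    using assms(3) by (intro continuous_intros)
  then have "open (V \<inter> (\<lambda>y. total_deriv f y v) -` {..<c})"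
    using assms(1) by (intro continuous_open_preimage) auto
  moreover have "x \<in> V \<inter> (\<lambda>y. total_deriv f y v) -` {..<c}"
    using assms(2,4) by simp
  ultimately obtain r where "r > 0" "ball x r \<subseteq> V \<inter> (\<lambda>y. total_deriv f y v) -` {..<c}"
    by (meson open_contains_ball)
  then show thesis
    by (intro that[of r]) auto
qed

lemma line_increment_less:
  fixes f :: "'a::real_normed_vector \<Rightarrow> real"
  assumes S: "convex S" "y \<in> S" "y + s *\<^sub>R v \<in> S" and s: "s > 0"
    and diff: "\<And>w. w \<in> S \<Longrightarrow> f differentiable (at w)"
    and less: "\<And>w. w \<in> S \<Longrightarrow> total_deriv f w v < c"
  shows "f (y + s *\<^sub>R v) < f y + s * c"
proof -
  have in_S: "y + t *\<^sub>R v \<in> S" if "0 \<le> t" "t \<le> s" for t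
  proof -
    have "(1 - t / s) *\<^sub>R y + (t / s) *\<^sub>R (y + s *\<^sub>R v) \<in> S"
      using S that s by (intro convexD) auto
    then show ?thesis
      using s by (simp add: algebra_simps)
  qed
  then have "((\<lambda>t. f (y + t *\<^sub>R v)) has_real_derivative total_deriv f (y + t *\<^sub>R v) v) (at t)"
    if "0 \<le> t" "t \<le> s" for t
    using that by (intro has_real_derivative_along_line diff)
  from MVT2[OF s this] obtain t
    where t: "0 < t" "t < s" "f (y + s *\<^sub>R v) - f (y + 0 *\<^sub>R v) = (s - 0) * total_deriv f (y + t *\<^sub>R v) v"
    by auto
  have "s * total_deriv f (y + t *\<^sub>R v) v < s * c"
    using less[OF in_S] t s by simp
  then show ?thesis
    using t(3) by simp
qed

section \<open>Non-convex open sets are touched from inside by concave arcs\<close>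

text \<open>The geometric core of the fact that a connected open set is convex once it is locally
  convex at its boundary. If \<open>X\<close> contains two sides of a triangle but not the third, one sweeps the
  triangle from \<open>b\<close> towards \<open>[a, c]\<close>, not with segments but with slightly bent arcs (the level sets
  of \<open>\<psi>\<close>), until the complement \<open>F\<close> of \<open>X\<close> is met at a point \<open>z\<close>. Near \<open>z\<close> an arc
  \<open>z + t h - t\<^sup>2 u\<close> lies in \<open>X\<close>, although it bends away from the side \<open>u\<close> on which \<open>X\<close>
  lies.

  The sweep is a maximisation of \<open>\<psi>\<close> minus a multiple of the squared distance to \<open>F\<close>. The penalty
  replaces the constraint of lying in \<open>F\<close>; its benefit is that the maximiser \<open>p\<close> is off \<open>F\<close>, so
  its nearest point \<open>z\<close> comes with a ball in \<open>X\<close> that touches \<open>F\<close> at \<open>z\<close> and controls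
  the directions transversal to the plane of the triangle.\<close>

lemma concave_touching_point:
  fixes X :: "'a::euclidean_space set"
  assumes X: "open X" and ab: "closed_segment a b \<subseteq> X" and bc: "closed_segment b c \<subseteq> X"
    and ac: "\<not> closed_segment a c \<subseteq> X"
  obtains z p h u \<delta> where "z \<notin> X" "ball p (dist p z) \<subseteq> X" "0 < (p - z) \<bullet> u" "\<delta> > 0"
    "\<And>t. t \<noteq> 0 \<Longrightarrow> \<bar>t\<bar> < \<delta> \<Longrightarrow> z + t *\<^sub>R h - t\<^sup>2 *\<^sub>R u \<in> X"
proof -
  define F where "F = - X"
  have "closed F"
    using X by (simp add: F_def closed_Compl)
  define P where "P \<alpha> \<beta> = b + \<alpha> *\<^sub>R (a - b) + \<beta> *\<^sub>R (c - b)" for \<alpha> \<beta> :: real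
  obtain y where y: "y \<in> closed_segment a c" "y \<in> F"
    using ac by (auto simp: F_def)
  then obtain s where s: "0 \<le> s" "s \<le> 1" "y = (1 - s) *\<^sub>R a + s *\<^sub>R c"
    by (auto simp: closed_segment_def)
  have y_P: "y = P (1 - s) s"
    by (simp add: s(3) P_def algebra_simps)
  have "F \<noteq> {}"
    using y by auto
  obtain e where e: "e > 0" "(\<Union>x\<in>closed_segment a b \<union> closed_segment b c. ball x e) \<subseteq> X"
    by (rule compact_subset_open_imp_ball_epsilon_subset[of "closed_segment a b \<union> closed_segment b c" X])
      (use X ab bc in auto)
  \<comment> \<open>The parameter triangle is extended beyond \<open>[a, c]\<close> by a margin \<open>\<eta>\<close> so small that the
    images of its two legs keep distance \<open>e / 2\<close> from \<open>F\<close>.\<close>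
  define l where "l = dist a b + dist b c + 1"
  have "l > 0"
    by (simp add: l_def add_nonneg_pos)
  define \<eta> where "\<eta> = min 1 (e / (2 * l))"
  have \<eta>: "0 < \<eta>" "\<eta> \<le> 1" "\<eta> * l \<le> e / 2"
    using e(1) \<open>l > 0\<close> by (auto simp: \<eta>_def min_def field_simps)
  have side: "e / 2 \<le> infdist q F"
    if x: "x \<in> closed_segment a b \<union> closed_segment b c" and q: "dist q x \<le> e / 2" for q x
  proof -
    obtain f where f: "f \<in> F" "infdist q F = dist q f"
      using infdist_attains_inf[OF \<open>closed F\<close> \<open>F \<noteq> {}\<close>] by metis
    have "ball x e \<subseteq> X"
      using e(2) x by blast
    then have "\<not> dist x f < e"
      using f(1) by (auto simp: F_def)
    with q f(2) show ?thesis
      using dist_triangle[of x f q] by (simp add: dist_commute)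
  qed
  have side1: "e / 2 \<le> infdist (P \<alpha> 0) F" if "0 \<le> \<alpha>" "\<alpha> \<le> 1 + \<eta>" for \<alpha>
  proof (rule side)
    show "b + min \<alpha> 1 *\<^sub>R (a - b) \<in> closed_segment a b \<union> closed_segment b c"
      using that unfolding closed_segment_commute[of a b]
      by (auto simp: closed_segment_def algebra_simps intro!: exI[of _ "min \<alpha> 1"])
    have "dist (P \<alpha> 0) (b + min \<alpha> 1 *\<^sub>R (a - b)) = (\<alpha> - min \<alpha> 1) * dist a b"
    proof -
      have "P \<alpha> 0 - (b + min \<alpha> 1 *\<^sub>R (a - b)) = (\<alpha> - min \<alpha> 1) *\<^sub>R (a - b)"
        by (simp add: P_def algebra_simps)
      then show ?thesis
        by (simp add: dist_norm)
    qed
    also have "\<dots> \<le> \<eta> * l"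
      using that \<eta>(1) by (intro mult_mono) (auto simp: l_def min_def)
    finally show "dist (P \<alpha> 0) (b + min \<alpha> 1 *\<^sub>R (a - b)) \<le> e / 2"
      using \<eta>(3) by simp
  qed
  have side2: "e / 2 \<le> infdist (P 0 \<beta>) F" if "0 \<le> \<beta>" "\<beta> \<le> 1 + \<eta>" for \<beta>
  proof (rule side)
    show "b + min \<beta> 1 *\<^sub>R (c - b) \<in> closed_segment a b \<union> closed_segment b c"
      using that by (auto simp: closed_segment_def algebra_simps intro!: exI[of _ "min \<beta> 1"])
    have "dist (P 0 \<beta>) (b + min \<beta> 1 *\<^sub>R (c - b)) = (\<beta> - min \<beta> 1) * dist b c"
    proof -
      have "P 0 \<beta> - (b + min \<beta> 1 *\<^sub>R (c - b)) = (\<beta> - min \<beta> 1) *\<^sub>R (c - b)"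
        by (simp add: P_def algebra_simps)
      then show ?thesis
        by (simp add: dist_norm norm_minus_commute)
    qed
    also have "\<dots> \<le> \<eta> * l"
      using that \<eta>(1) by (intro mult_mono) (auto simp: l_def min_def)
    finally show "dist (P 0 \<beta>) (b + min \<beta> 1 *\<^sub>R (c - b)) \<le> e / 2"
      using \<eta>(3) by simp
  qed
  \<comment> \<open>On the triangle the curvature term of \<open>\<psi>\<close> is at most \<open>4 \<epsilon> = \<eta> / 2\<close>, so \<open>\<psi> < - 1\<close> on the
    hypotenuse; the penalty is at least \<open>2\<close> on the legs. Hence neither can carry the maximum, because
    \<open>y\<close> has value at least \<open>- 1\<close>.\<close>
  define \<epsilon> where "\<epsilon> = \<eta> / 8"
  define M where "M = 8 / e\<^sup>2"
  have "\<epsilon> > 0" "M > 0"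
    using \<eta>(1) e(1) by (auto simp: \<epsilon>_def M_def)
  define \<psi> where "\<psi> \<alpha> \<beta> = - (\<alpha> + \<beta>) + \<epsilon> * (\<alpha> - \<beta>)\<^sup>2" for \<alpha> \<beta> :: real
  define \<Psi> where "\<Psi> q = \<psi> (fst q) (snd q) - M * (infdist (P (fst q) (snd q)) F)\<^sup>2" for q
  define D where "D = cbox (0, 0) (2, 2) \<inter> {q :: real \<times> real. fst q + snd q \<le> 1 + \<eta>}"
  have D_iff: "(\<alpha>, \<beta>) \<in> D \<longleftrightarrow> 0 \<le> \<alpha> \<and> 0 \<le> \<beta> \<and> \<alpha> + \<beta> \<le> 1 + \<eta>" for \<alpha> \<beta>
    using \<eta>(2) by (auto simp: D_def cbox_Pair_eq)
  have "compact D"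
    unfolding D_def
    by (intro compact_Int_closed compact_cbox closed_Collect_le continuous_intros)
  moreover have "(1 - s, s) \<in> D"
    using s \<eta>(1) by (simp add: D_iff)
  moreover have "continuous_on D \<Psi>"
    unfolding \<Psi>_def \<psi>_def P_def by (intro continuous_intros)
  ultimately obtain q where "q \<in> D" and q_max: "\<And>q'. q' \<in> D \<Longrightarrow> \<Psi> q' \<le> \<Psi> q"
    using continuous_attains_sup[of D \<Psi>] by (metis empty_iff)
  obtain \<alpha> \<beta> where q: "q = (\<alpha>, \<beta>)"
    by (cases q)
  have \<alpha>\<beta>: "0 \<le> \<alpha>" "0 \<le> \<beta>" "\<alpha> + \<beta> \<le> 1 + \<eta>"
    using \<open>q \<in> D\<close> by (auto simp: q D_iff)
  define p where "p = P \<alpha> \<beta>"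
  obtain z where z: "z \<in> F" "infdist p F = dist p z"
    using infdist_attains_inf[OF \<open>closed F\<close> \<open>F \<noteq> {}\<close>] by metis

  have "\<Psi> (1 - s, s) \<ge> -1"
    using y(2) y_P \<open>\<epsilon> > 0\<close> by (auto simp: \<Psi>_def \<psi>_def)
  then have ge: "\<Psi> q \<ge> -1"
    using q_max[OF \<open>(1 - s, s) \<in> D\<close>] by simp
  have small: "\<epsilon> * (\<alpha> - \<beta>)\<^sup>2 \<le> \<eta> / 2"
  proof -
    have "\<bar>\<alpha> - \<beta>\<bar> \<le> 2"
      using \<alpha>\<beta> \<eta>(2) by auto
    then have "(\<alpha> - \<beta>)\<^sup>2 \<le> 2\<^sup>2"
      by (metis abs_le_square_iff abs_numeral)
    then show ?thesis
      using \<eta>(1) by (simp add: \<epsilon>_def)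
  qed
  have far: False if "e / 2 \<le> infdist p F"
  proof -
    have "(e / 2)\<^sup>2 \<le> (infdist p F)\<^sup>2"
      using that e(1) by (intro power_mono) auto
    then have "M * (e / 2)\<^sup>2 \<le> M * (infdist p F)\<^sup>2"
      using \<open>M > 0\<close> by simp
    moreover have "M * (e / 2)\<^sup>2 = 2"
      using e(1) by (simp add: M_def power_divide)
    ultimately show False
      using ge small \<alpha>\<beta> \<eta> by (simp add: \<Psi>_def \<psi>_def q p_def)
  qed
  have "\<alpha> > 0"
    using far side2[of \<beta>] \<alpha>\<beta> by (cases "\<alpha> = 0") (auto simp: p_def)
  have "\<beta> > 0"
    using far side1[of \<alpha>] \<alpha>\<beta> by (cases "\<beta> = 0") (auto simp: p_def)
  have "\<alpha> + \<beta> < 1 + \<eta>"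
  proof (rule ccontr)
    assume "\<not> \<alpha> + \<beta> < 1 + \<eta>"
    with small have "\<psi> \<alpha> \<beta> < -1"
      using \<eta>(1) by (simp add: \<psi>_def)
    moreover have "M * (infdist p F)\<^sup>2 \<ge> 0"
      using \<open>M > 0\<close> by simp
    ultimately show False
      using ge by (simp add: \<Psi>_def q p_def)
  qed
  \<comment> \<open>The maximising parameters are interior, so they may be varied freely by less than \<open>r\<close>. Replacing
    the distance to \<open>F\<close> by the distance to one chosen point of \<open>F\<close> only weakens the inequality.\<close>
  define r where "r = min (min \<alpha> \<beta>) ((1 + \<eta> - \<alpha> - \<beta>) / 2)"
  have "r > 0"
    using \<open>\<alpha> > 0\<close> \<open>\<beta> > 0\<close> \<open>\<alpha> + \<beta> < 1 + \<eta>\<close> by (simp add: r_def)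
  have max: "\<psi> (\<alpha> + x) (\<beta> + y) - M * (dist (P (\<alpha> + x) (\<beta> + y)) f)\<^sup>2 \<le> \<psi> \<alpha> \<beta> - M * (dist p z)\<^sup>2"
    if "\<bar>x\<bar> < r" "\<bar>y\<bar> < r" "f \<in> F" for x y f
  proof -
    have "(\<alpha> + x, \<beta> + y) \<in> D"
      using that(1,2) by (auto simp: D_iff r_def min_def split: if_splits)
    then have "\<Psi> (\<alpha> + x, \<beta> + y) \<le> \<Psi> q"
      by (rule q_max)
    moreover have "M * (infdist (P (\<alpha> + x) (\<beta> + y)) F)\<^sup>2 \<le> M * (dist (P (\<alpha> + x) (\<beta> + y)) f)\<^sup>2"
      using \<open>M > 0\<close> infdist_le[OF that(3)] by (simp add: power_mono infdist_nonneg)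
    ultimately show ?thesis
      using z(2) by (simp add: \<Psi>_def q p_def)
  qed
  \<comment> \<open>Shifting both parameters by \<open>- \<tau>\<close> moves the image along \<open>w\<close>, away from the line through \<open>a\<close> and \<open>c\<close>; shifting them
    oppositely by \<open>t\<close> moves it parallel to \<open>a - c\<close>.\<close>
  define w where "w = (b - a) + (b - c)"
  define \<sigma> where "\<sigma> = \<alpha> - \<beta>"
  have shift: "P (\<alpha> + (t - \<tau>)) (\<beta> + (- t - \<tau>)) = p + t *\<^sub>R (a - c) + \<tau> *\<^sub>R w" for t \<tau>
    by (simp add: P_def p_def w_def algebra_simps)
  have \<psi>_shift: "\<psi> (\<alpha> + (t - \<tau>)) (\<beta> + (- t - \<tau>)) = \<psi> \<alpha> \<beta> + 2 * \<tau> + 4 * \<epsilon> * \<sigma> * t + 4 * \<epsilon> * t\<^sup>2" for t \<tau>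
    by (simp add: \<psi>_def \<sigma>_def algebra_simps power2_eq_square)

  \<comment> \<open>Moving \<open>p\<close> with \<open>z\<close> kept fixed: the first order gain \<open>2 \<tau>\<close> has to be paid by the penalty, so
    \<open>p\<close> differs from \<open>z\<close> and moving along \<open>w\<close> leads away from \<open>z\<close>.\<close>
  have pos: "0 < (p - z) \<bullet> w"
  proof (rule ccontr)
    assume neg: "\<not> 0 < (p - z) \<bullet> w"
    define N where "N = (norm w)\<^sup>2 + 1"
    have "N > 0"
      by (simp add: N_def add_nonneg_pos)
    define \<tau> where "\<tau> = min (r / 2) (1 / (M * N))"
    have \<tau>: "0 < \<tau>" "\<tau> < r" "\<tau> * (M * N) \<le> 1"
      using \<open>r > 0\<close> \<open>M > 0\<close> \<open>N > 0\<close> by (auto simp: \<tau>_def min_def field_simps)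
    have "\<psi> \<alpha> \<beta> + 2 * \<tau> - M * (dist (p + \<tau> *\<^sub>R w) z)\<^sup>2 \<le> \<psi> \<alpha> \<beta> - M * (dist p z)\<^sup>2"
      using max[of "0 - \<tau>" "- 0 - \<tau>" z] \<tau> z(1) unfolding shift \<psi>_shift by simp
    moreover have "(dist (p + \<tau> *\<^sub>R w) z)\<^sup>2 = (dist p z)\<^sup>2 + 2 * \<tau> * ((p - z) \<bullet> w) + \<tau>\<^sup>2 * (norm w)\<^sup>2"
      unfolding dist_norm power2_norm_eq_inner
      by (simp add: algebra_simps inner_commute power2_eq_square)
    moreover have "2 * \<tau> * ((p - z) \<bullet> w) \<le> 0"
      using neg \<tau> by (simp add: mult_nonneg_nonpos)
    moreover have "\<tau>\<^sup>2 * (norm w)\<^sup>2 \<le> \<tau>\<^sup>2 * N"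
      by (intro mult_left_mono) (auto simp: N_def)
    ultimately have "2 * \<tau> \<le> M * (\<tau>\<^sup>2 * N)"
      using \<open>M > 0\<close> by (smt (verit, ccfv_SIG) distrib_left mult_left_mono)
    also have "\<dots> = \<tau> * (\<tau> * (M * N))"
      by (simp add: power2_eq_square)
    also have "\<dots> \<le> \<tau> * 1"
      using \<tau> by (intro mult_left_mono) auto
    finally show False
      using \<tau> by simp
  qed

  \<comment> \<open>Moving \<open>p\<close> and \<open>z\<close> together leaves the penalty unchanged, so \<open>z\<close> has to leave \<open>F\<close> as soon as
    \<open>\<psi>\<close> grows. The shift \<open>\<tau>\<close> below cancels the linear term and spends half of the gain
    \<open>4 \<epsilon> t\<^sup>2\<close>.\<close>
  define \<delta> where "\<delta> = min 1 (r / 2)"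
  define h where "h = a - c - (2 * \<epsilon> * \<sigma>) *\<^sub>R w"
  have arc: "z + t *\<^sub>R h - t\<^sup>2 *\<^sub>R (\<epsilon> *\<^sub>R w) \<in> X" if t: "t \<noteq> 0" "\<bar>t\<bar> < \<delta>" for t
  proof (rule ccontr)
    define \<tau> where "\<tau> = - 2 * \<epsilon> * \<sigma> * t - \<epsilon> * t\<^sup>2"
    assume "\<not> ?thesis"
    moreover have "z + t *\<^sub>R h - t\<^sup>2 *\<^sub>R (\<epsilon> *\<^sub>R w) = z + t *\<^sub>R (a - c) + \<tau> *\<^sub>R w"
      by (simp add: h_def \<tau>_def algebra_simps)
    ultimately have inF: "z + t *\<^sub>R (a - c) + \<tau> *\<^sub>R w \<in> F"
      by (metis ComplI F_def)
    have "\<bar>t\<bar> \<le> 1" "2 * \<bar>t\<bar> < r"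
      using t by (auto simp: \<delta>_def)
    have "\<bar>\<tau>\<bar> \<le> \<bar>t\<bar>"
    proof -
      have "\<bar>\<sigma>\<bar> \<le> 2"
        using \<alpha>\<beta> \<eta>(2) by (auto simp: \<sigma>_def)
      have "\<tau> = - (\<epsilon> * (2 * \<sigma> + t)) * t"
        by (simp add: \<tau>_def algebra_simps power2_eq_square)
      then have "\<bar>\<tau>\<bar> = \<epsilon> * \<bar>2 * \<sigma> + t\<bar> * \<bar>t\<bar>"
        using \<open>\<epsilon> > 0\<close> by (simp add: abs_mult)
      also have "\<dots> \<le> (1 / 8 * 5) * \<bar>t\<bar>"
        using \<open>\<bar>\<sigma>\<bar> \<le> 2\<close> \<open>\<bar>t\<bar> \<le> 1\<close> \<eta>(1,2) by (intro mult_right_mono mult_mono) (auto simp: \<epsilon>_def)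
      finally show ?thesis
        by simp
    qed
    then have "\<bar>t - \<tau>\<bar> < r" "\<bar>- t - \<tau>\<bar> < r"
      using \<open>2 * \<bar>t\<bar> < r\<close> by linarith+
    from max[OF this inF]
    have "2 * \<tau> + 4 * \<epsilon> * \<sigma> * t + 4 * \<epsilon> * t\<^sup>2 \<le> 0"
      unfolding shift \<psi>_shift by (simp add: dist_norm)
    then have "2 * \<epsilon> * t\<^sup>2 \<le> 0"
      by (simp add: \<tau>_def)
    with \<open>\<epsilon> > 0\<close> \<open>t \<noteq> 0\<close> show False
      by (simp add: mult_le_0_iff)
  qed
  show thesis
  proof (rule that[of z p "\<epsilon> *\<^sub>R w" \<delta> h])
    show "z \<notin> X"
      using z(1) by (simp add: F_def)
    show "ball p (dist p z) \<subseteq> X"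
    proof
      fix x assume "x \<in> ball p (dist p z)"
      then have "x \<notin> F"
        using infdist_le[of x F p] z(2) by auto
      then show "x \<in> X"
        by (simp add: F_def)
    qed
    show "0 < (p - z) \<bullet> \<epsilon> *\<^sub>R w"
      using pos \<open>\<epsilon> > 0\<close> by simp
    show "\<delta> > 0"
      using \<open>r > 0\<close> by (simp add: \<delta>_def)
    show "\<And>t. t \<noteq> 0 \<Longrightarrow> \<bar>t\<bar> < \<delta> \<Longrightarrow> z + t *\<^sub>R h - t\<^sup>2 *\<^sub>R (\<epsilon> *\<^sub>R w) \<in> X"
      by (rule arc)
  qed
qed

section \<open>The second order condition excludes concave arcs\<close>

text \<open>The arc runs through \<open>z\<close> in both time directions, so \<open>f\<close> has a local maximum along it; the
  quadratic correction is invisible to the derivative at \<open>t = 0\<close>.\<close>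

lemma total_deriv_zero_along_arc:
  fixes f :: "'a::real_normed_vector \<Rightarrow> real"
  assumes diff: "f differentiable (at z)" and "\<delta> > 0"
    and le: "\<And>t. \<bar>t\<bar> < \<delta> \<Longrightarrow> f (z + t *\<^sub>R h - t\<^sup>2 *\<^sub>R u) \<le> f z"
  shows "total_deriv f z h = 0"
proof -
  have "((\<lambda>t. z + t *\<^sub>R h - t\<^sup>2 *\<^sub>R u) has_derivative (\<lambda>t. t *\<^sub>R h)) (at 0)"
    by (auto intro!: derivative_eq_intros)
  moreover have "(f has_derivative total_deriv f z) (at (z + 0 *\<^sub>R h - 0\<^sup>2 *\<^sub>R u))"
    using has_derivative_total_deriv[OF diff] by simp
  ultimately have "((\<lambda>t. f (z + t *\<^sub>R h - t\<^sup>2 *\<^sub>R u)) has_derivative (\<lambda>t. total_deriv f z (t *\<^sub>R h))) (at 0)"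
    by (rule has_derivative_compose)
  then have "((\<lambda>t. f (z + t *\<^sub>R h - t\<^sup>2 *\<^sub>R u)) has_real_derivative total_deriv f z h) (at 0)"
    by (rule has_derivative_imp_has_field_derivative) (simp add: blinfun.scaleR_right mult.commute)
  then show ?thesis
    by (rule DERIV_local_max[OF _ \<open>\<delta> > 0\<close>]) (use le in auto)
qed

text \<open>The directions pointing from a boundary point into a ball fill an open half space, on which the
  derivative is nonpositive; being nonzero, it is negative there.\<close>

lemma total_deriv_neg_into_ball:
  fixes f :: "'a::real_inner \<Rightarrow> real"
  assumes diff: "f differentiable (at z)" and surj: "surj (blinfun_apply (total_deriv f z))"
    and le: "\<And>y. y \<in> ball p (dist p z) \<Longrightarrow> f y \<le> f z"
    and u: "0 < (p - z) \<bullet> u"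
  shows "total_deriv f z u < 0"
proof (rule functional_neg_on_interior[OF surj], rule interiorI)
  show "open {v. 0 < (p - z) \<bullet> v}"
    by (intro open_Collect_less continuous_intros)
  show "u \<in> {v. 0 < (p - z) \<bullet> v}"
    using u by simp
  show "{v. 0 < (p - z) \<bullet> v} \<subseteq> {v. total_deriv f z v \<le> 0}"
  proof clarify
    fix v assume v: "0 < (p - z) \<bullet> v"
    have "((\<lambda>t. t * (norm v)\<^sup>2) \<longlongrightarrow> 0 * (norm v)\<^sup>2) (at_right (0::real))"
      by (intro tendsto_intros)
    then have "\<forall>\<^sub>F t in at_right (0::real). t * (norm v)\<^sup>2 < 2 * ((p - z) \<bullet> v)"
      using v by (intro order_tendstoD) auto
    moreover have "\<forall>\<^sub>F t in at_right (0::real). 0 < t"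
      by (simp add: eventually_at_right_less)
    ultimately have "\<forall>\<^sub>F t in at_right 0. f (z + t *\<^sub>R v) \<le> f z"
    proof eventually_elim
      case (elim t)
      have "(dist p (z + t *\<^sub>R v))\<^sup>2 = (dist p z)\<^sup>2 + t * (t * (norm v)\<^sup>2 - 2 * ((p - z) \<bullet> v))"
        unfolding dist_norm power2_norm_eq_inner
        by (simp add: algebra_simps inner_commute power2_eq_square)
      moreover have "t * (t * (norm v)\<^sup>2 - 2 * ((p - z) \<bullet> v)) < 0"
        using elim by (intro mult_pos_neg) auto
      ultimately have "(dist p (z + t *\<^sub>R v))\<^sup>2 < (dist p z)\<^sup>2"
        by simp
      then have "dist p (z + t *\<^sub>R v) < dist p z"
        by (rule power_less_imp_less_base) simp
      then show ?case
        by (intro le) simp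
    qed
    then show "total_deriv f z v \<le> 0"
      by (rule total_deriv_nonpos_if_nonincreasing[OF diff])
  qed
qed

text \<open>Going from the arc to the line \<open>z + t h\<close> means moving by \<open>t\<^sup>2 u\<close>, which decreases \<open>f\<close> by at
  least \<open>c t\<^sup>2\<close>. The second order condition allows only a decrease of \<open>o(t\<^sup>2)\<close> along that
  line.\<close>

lemma not_second_order_cond_on_concave_arc:
  fixes f :: "'a::real_normed_vector \<Rightarrow> real"
  assumes V: "open V" "z \<in> V" "\<And>y. y \<in> V \<Longrightarrow> f differentiable (at y)"
      "continuous_on V (total_deriv f)"
    and u: "total_deriv f z u < 0" and "\<delta> > 0"
    and le: "\<And>t. \<bar>t\<bar> < \<delta> \<Longrightarrow> f (z + t *\<^sub>R h - t\<^sup>2 *\<^sub>R u) \<le> f z"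
  shows "\<not> second_order_cond f z h"
proof
  assume soc: "second_order_cond f z h"
  define c where "c = - total_deriv f z u / 2"
  have "c > 0" "total_deriv f z u < - c"
    using u by (auto simp: c_def)
  obtain r where r: "r > 0" "ball z r \<subseteq> V" "\<And>y. y \<in> ball z r \<Longrightarrow> total_deriv f y u < - c"
    using total_deriv_nbhd[OF V(1,2,4) \<open>total_deriv f z u < - c\<close>] by metis
  have "((\<lambda>t. z + t *\<^sub>R h) \<longlongrightarrow> z + 0 *\<^sub>R h) (at_right (0::real))"
    by (intro tendsto_intros)
  then have ev1: "\<forall>\<^sub>F t in at_right (0::real). z + t *\<^sub>R h \<in> ball z r"
    by (rule topological_tendstoD) (use r(1) in auto)
  have "((\<lambda>t. z + t *\<^sub>R h - t\<^sup>2 *\<^sub>R u) \<longlongrightarrow> z + 0 *\<^sub>R h - 0\<^sup>2 *\<^sub>R u) (at_right (0::real))"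
    by (intro tendsto_intros)
  then have ev2: "\<forall>\<^sub>F t in at_right (0::real). z + t *\<^sub>R h - t\<^sup>2 *\<^sub>R u \<in> ball z r"
    by (rule topological_tendstoD) (use r(1) in auto)
  have ev3: "\<forall>\<^sub>F t in at_right (0::real). 0 < t \<and> t < \<delta>"
    using \<open>\<delta> > 0\<close> by (auto simp: eventually_at_right)
  obtain t where t: "z + t *\<^sub>R h \<in> ball z r" "z + t *\<^sub>R h - t\<^sup>2 *\<^sub>R u \<in> ball z r"
    "0 < t" "t < \<delta>" "f z - c * t\<^sup>2 \<le> f (z + t *\<^sub>R h)"
    using eventually_happens[OF eventually_conj[OF ev1 eventually_conj[OF ev2
          eventually_conj[OF ev3 second_order_cond_lower_bound[OF V(1-3) soc \<open>c > 0\<close>]]]]]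
    by (auto simp del: mem_ball)
  have "f (z + t *\<^sub>R h - t\<^sup>2 *\<^sub>R u + t\<^sup>2 *\<^sub>R u) < f (z + t *\<^sub>R h - t\<^sup>2 *\<^sub>R u) + t\<^sup>2 * - c"
    by (rule line_increment_less[of "ball z r"]) (use t r V(3) in auto)
  moreover have "f (z + t *\<^sub>R h - t\<^sup>2 *\<^sub>R u) \<le> f z"
    using t by (intro le) auto
  ultimately show False
    using t(5) by (simp add: algebra_simps)
qed

section \<open>Convexity from transitivity of visibility\<close>

text \<open>Visibility inside the interior of \<open>\<Omega>\<close> is an equivalence relation if it is transitive, and
  connectedness reduces it to a local statement. The connected set is \<open>\<Omega>\<close> itself, not its
  interior: around a boundary point, any two interior points see each other along a path of three
  segments that goes up in the direction \<open>v\<close>, across, and down again.\<close>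

lemma convex_if_interior_segments_transitive:
  fixes \<Omega> :: "'a::euclidean_space set"
  assumes closed: "closed \<Omega>" and conn: "connected \<Omega>"
    and push: "\<And>x. x \<in> frontier \<Omega> \<Longrightarrow> \<exists>v. \<exists>r>0. \<forall>y\<in>\<Omega> \<inter> ball x r. \<forall>s>0.
      y + s *\<^sub>R v \<in> ball x r \<longrightarrow> y + s *\<^sub>R v \<in> interior \<Omega>"
    and trans: "\<And>a b c. closed_segment a b \<subseteq> interior \<Omega> \<Longrightarrow> closed_segment b c \<subseteq> interior \<Omega> \<Longrightarrow>
      closed_segment a c \<subseteq> interior \<Omega>"
  shows "convex \<Omega>"
proof -
  have frontier: "x \<in> interior \<Omega> \<or> x \<in> frontier \<Omega>" if "x \<in> \<Omega>" for x
    using that closure_subset[of \<Omega>] by (auto simp: frontier_def)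
  have small: "\<exists>s>0. s * norm v < r" if "r > 0" for r :: real and v :: 'a
  proof (intro exI conjI)
    have "norm v + 1 > 0"
      by (simp add: add_nonneg_pos)
    then show "r / (norm v + 1) > 0"
      using that by simp
    show "r / (norm v + 1) * norm v < r"
      using \<open>norm v + 1 > 0\<close> that by (simp add: field_simps)
  qed
  have dense: "\<exists>z\<in>\<Omega> \<inter> ball a e. z \<in> interior \<Omega>" if "a \<in> \<Omega>" and e: "e > 0" for a e
    using frontier[OF that(1)]
  proof
    assume "a \<in> interior \<Omega>"
    then show ?thesis
      using that by auto
  next
    assume "a \<in> frontier \<Omega>"
    from push[OF this] obtain v r where vr: "r > 0"
      "\<And>y s. y \<in> \<Omega> \<inter> ball a r \<Longrightarrow> s > 0 \<Longrightarrow> y + s *\<^sub>R v \<in> ball a r \<Longrightarrow> y + s *\<^sub>R v \<in> interior \<Omega>"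
      by blast
    obtain s where s: "s > 0" "s * norm v < min r e"
      using small[of "min r e" v] vr(1) e by auto
    have "a + s *\<^sub>R v \<in> interior \<Omega>"
      using vr(1) s that by (intro vr(2)) (auto simp: dist_norm)
    then show ?thesis
      using s interior_subset[of \<Omega>] by (intro bexI[of _ "a + s *\<^sub>R v"]) (auto simp: dist_norm)
  qed
  have segments: "closed_segment a b \<subseteq> interior \<Omega>" if "a \<in> interior \<Omega>" "b \<in> interior \<Omega>" for a b
  proof (rule connected_equivalence_relation_gen[OF conn, of a b "\<lambda>x. x \<in> interior \<Omega>"
        "\<lambda>x y. closed_segment x y \<subseteq> interior \<Omega>"])
    show "a \<in> \<Omega>" "b \<in> \<Omega>" "a \<in> interior \<Omega>" "b \<in> interior \<Omega>"
      using that interior_subset by auto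
    show "closed_segment x z \<subseteq> interior \<Omega>"
      if "closed_segment x y \<subseteq> interior \<Omega>" "closed_segment y z \<subseteq> interior \<Omega>" for x y z
      using trans that by blast
    show "\<exists>z. z \<in> T \<and> z \<in> interior \<Omega>" if "openin (top_of_set \<Omega>) T" "x \<in> T" for T x
    proof -
      obtain e where "e > 0" "ball x e \<inter> \<Omega> \<subseteq> T" "x \<in> \<Omega>"
        using \<open>openin (top_of_set \<Omega>) T\<close> \<open>x \<in> T\<close> unfolding openin_contains_ball by blast
      then show ?thesis
        using dense[of x e] by blast
    qed
    show "\<exists>T. openin (top_of_set \<Omega>) T \<and> x \<in> T \<and>
        (\<forall>y\<in>T. \<forall>z\<in>T. y \<in> interior \<Omega> \<and> z \<in> interior \<Omega> \<longrightarrow> closed_segment y z \<subseteq> interior \<Omega>)"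
      if "x \<in> \<Omega>" for x
      using frontier[OF that]
    proof
      assume "x \<in> interior \<Omega>"
      then obtain e where e: "e > 0" "ball x e \<subseteq> interior \<Omega>"
        using open_contains_ball open_interior by metis
      show ?thesis
      proof (intro exI[of _ "\<Omega> \<inter> ball x e"] conjI ballI impI)
        show "openin (top_of_set \<Omega>) (\<Omega> \<inter> ball x e)"
          by (simp add: openin_open_Int)
        show "x \<in> \<Omega> \<inter> ball x e"
          using that e by simp
        show "closed_segment y z \<subseteq> interior \<Omega>" if "y \<in> \<Omega> \<inter> ball x e" "z \<in> \<Omega> \<inter> ball x e" for y z
          using that e(2) closed_segment_subset[of y "ball x e" z] by auto
      qed
    next
      assume "x \<in> frontier \<Omega>"
      from push[OF this] obtain v r where vr: "r > 0"
        "\<And>y s. y \<in> \<Omega> \<inter> ball x r \<Longrightarrow> s > 0 \<Longrightarrow> y + s *\<^sub>R v \<in> ball x r \<Longrightarrow> y + s *\<^sub>R v \<in> interior \<Omega>"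
        by blast
      obtain s where s: "s > 0" "s * norm v < r / 2"
        using small[of "r / 2" v] vr(1) by auto
      have "x + s *\<^sub>R v \<in> interior \<Omega>"
        using vr(1) s that by (intro vr(2)) (auto simp: dist_norm)
      then obtain e where e: "e > 0" "ball (x + s *\<^sub>R v) e \<subseteq> interior \<Omega>"
        using open_contains_ball open_interior by metis
      define T where "T = \<Omega> \<inter> ball x (min e (r / 2))"
      have up: "closed_segment y (y + s *\<^sub>R v) \<subseteq> interior \<Omega>" if y: "y \<in> T" "y \<in> interior \<Omega>" for y
      proof
        fix w assume "w \<in> closed_segment y (y + s *\<^sub>R v)"
        then obtain \<theta> where \<theta>: "0 \<le> \<theta>" "\<theta> \<le> 1" "w = y + (\<theta> * s) *\<^sub>R v"
          by (auto simp: closed_segment_def algebra_simps)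
        have "\<theta> * (s * norm v) \<le> 1 * (s * norm v)"
          using \<theta> s by (intro mult_right_mono) auto
        moreover have "dist y w = \<theta> * (s * norm v)"
          using s(1) \<theta> by (simp add: dist_norm abs_mult)
        ultimately have "dist y w < r / 2"
          using s(2) by linarith
        moreover have "dist x y < r / 2"
          using y by (simp add: T_def)
        ultimately have "w \<in> ball x r"
          using dist_triangle[of x w y] by simp
        show "w \<in> interior \<Omega>"
        proof (cases "\<theta> = 0")
          case True
          then show ?thesis
            using y \<theta> by simp
        next
          case False
          then show ?thesis
            using \<open>w \<in> ball x r\<close> \<theta> s y vr(1) unfolding \<theta>(3)
            by (intro vr(2)) (auto simp: T_def)
        qed
      qed
      show ?thesis
      proof (intro exI[of _ T] conjI ballI impI)
        show "openin (top_of_set \<Omega>) T"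
          by (simp add: T_def openin_open_Int)
        show "x \<in> T"
          using that e vr(1) by (simp add: T_def)
        fix y z assume yz: "y \<in> T" "z \<in> T" "y \<in> interior \<Omega> \<and> z \<in> interior \<Omega>"
        have "closed_segment (y + s *\<^sub>R v) (z + s *\<^sub>R v) \<subseteq> ball (x + s *\<^sub>R v) e"
          using yz by (intro closed_segment_subset) (auto simp: T_def dist_norm)
        then have "closed_segment (y + s *\<^sub>R v) (z + s *\<^sub>R v) \<subseteq> interior \<Omega>"
          using e(2) by blast
        moreover have "closed_segment (z + s *\<^sub>R v) z \<subseteq> interior \<Omega>"
          using up yz by (metis closed_segment_commute)
        ultimately show "closed_segment y z \<subseteq> interior \<Omega>"
          using up yz trans by meson
      qed
    qed
  qed
  have "\<Omega> \<subseteq> closure (interior \<Omega>)"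
    using dense by (fastforce simp: closure_approachable dist_commute)
  moreover have "closure (interior \<Omega>) \<subseteq> \<Omega>"
    using closed interior_subset by (metis closure_minimal)
  moreover have "convex (interior \<Omega>)"
    using segments by (simp add: convex_contains_segment)
  ultimately show ?thesis
    by (metis convex_closure subset_antisym)
qed

section \<open>Constraints near a feasible point\<close>

lemma strictly_feasible_interior:
  assumes "open U" "\<And>i. i \<in> {1..m} \<Longrightarrow> continuous_on U (g i)"
    and "y \<in> U" "\<And>i. i \<in> {1..m} \<Longrightarrow> g i y < (0::real)"
  shows "y \<in> interior (feasible_set U m g)"
proof (rule interiorI)
  show "open (U \<inter> (\<Inter>i\<in>{1..m}. U \<inter> g i -` {..<0}))"
    using assms(1,2) by (intro open_Int open_INT ballI continuous_open_preimage) auto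
  show "y \<in> U \<inter> (\<Inter>i\<in>{1..m}. U \<inter> g i -` {..<0})"
    using assms(3,4) by auto
  show "U \<inter> (\<Inter>i\<in>{1..m}. U \<inter> g i -` {..<0}) \<subseteq> feasible_set U m g"
    by (auto simp: feasible_set_def less_imp_le)
qed

lemma common_radius:
  assumes "finite I" and "\<And>i. i \<in> I \<Longrightarrow> \<exists>r>0. P i (r::real)"
    and "\<And>i r r'. i \<in> I \<Longrightarrow> P i r \<Longrightarrow> 0 < r' \<Longrightarrow> r' \<le> r \<Longrightarrow> P i r'"
  shows "\<exists>r>0. \<forall>i\<in>I. P i r"
proof -
  obtain \<rho> where \<rho>: "\<And>i. i \<in> I \<Longrightarrow> \<rho> i > 0 \<and> P i (\<rho> i)"
    using assms(2) by metis
  define r where "r = Min (insert 1 (\<rho> ` I))"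
  have "r > 0"
    unfolding r_def using assms(1) \<rho> by (subst Min_gr_iff) auto
  moreover have "r \<le> \<rho> i" if "i \<in> I" for i
    unfolding r_def using assms(1) that by (intro Min_le) auto
  ultimately have "P i r" if "i \<in> I" for i
    using assms(3) \<rho> that by blast
  with \<open>r > 0\<close> show ?thesis
    by blast
qed

lemma inactive_constraint_nbhd:
  fixes f :: "'a::metric_space \<Rightarrow> real"
  assumes "open U" "continuous_on U f" "x \<in> U" "f x < 0"
  shows "\<exists>r>0. \<forall>y\<in>ball x r. y \<in> U \<and> f y < 0"
proof -
  have "open (U \<inter> f -` {..<0})"
    using assms by (intro continuous_open_preimage) auto
  moreover have "x \<in> U \<inter> f -` {..<0}"
    using assms(3,4) by simp
  ultimately obtain r where "r > 0" "ball x r \<subseteq> U \<inter> f -` {..<0}"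
    by (meson open_contains_ball)
  then show ?thesis
    by (intro exI[of _ r]) auto
qed

lemma C11_submersion_at_zero:
  assumes "C11_submersion_on_zeros U f" "x \<in> U" "f x = 0"
  obtains V where "open V" "x \<in> V" "C11_on V f" "surj (blinfun_apply (total_deriv f x))"
proof -
  have "(\<exists>V. open V \<and> x \<in> V \<and> V \<subseteq> U \<and> C11_on V f) \<and> surj (blinfun_apply (total_deriv f x))"
    using assms by (simp add: C11_submersion_on_zeros_def)
  then show thesis
    using that by metis
qed

text \<open>An interior direction of the linearized cone strictly decreases all active constraints to first
  order (the Mangasarian--Fromovitz condition), and by continuity of the derivatives it does so
  uniformly near \<open>x\<close>.\<close>

lemma feasible_push:
  fixes g :: "nat \<Rightarrow> 'a::real_normed_vector \<Rightarrow> real"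
  assumes U: "open U" and cont: "\<And>i. i \<in> {1..m} \<Longrightarrow> continuous_on U (g i)"
    and C11: "\<And>i. i \<in> {1..m} \<Longrightarrow> C11_submersion_on_zeros U (g i)"
    and x: "x \<in> feasible_set U m g"
    and v: "v \<in> interior (linearized_cone m g x)"
  shows "\<exists>r>0. \<forall>y\<in>feasible_set U m g \<inter> ball x r. \<forall>s>0.
    y + s *\<^sub>R v \<in> ball x r \<longrightarrow> y + s *\<^sub>R v \<in> interior (feasible_set U m g)"
proof -
  define P where "P i r \<longleftrightarrow> (\<forall>y\<in>ball x r. \<forall>s>0. g i y \<le> 0 \<longrightarrow> y + s *\<^sub>R v \<in> ball x r \<longrightarrow>
    g i (y + s *\<^sub>R v) < 0)" for i r
  have "x \<in> U"
    using x by (simp add: feasible_set_def)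
  have "\<exists>r>0. \<forall>i\<in>{1..m}. P i r"
  proof (rule common_radius)
    fix i assume i: "i \<in> {1..m}"
    show "\<exists>r>0. P i r"
    proof (cases "g i x = 0")
      case False
      then have "g i x < 0"
        using x i by (force simp: feasible_set_def)
      then show ?thesis
        using inactive_constraint_nbhd[OF U cont[OF i] \<open>x \<in> U\<close>] unfolding P_def by blast
    next
      case True
      obtain V where V: "open V" "x \<in> V" "C11_on V (g i)"
        and surj: "surj (blinfun_apply (total_deriv (g i) x))"
        using C11_submersion_at_zero[OF C11[OF i] \<open>x \<in> U\<close> True] by metis
      have "linearized_cone m g x \<subseteq> {h. total_deriv (g i) x h \<le> 0}"
        using i True by (auto simp: linearized_cone_def active_set_def)
      then have "total_deriv (g i) x v < 0"
        using v by (intro functional_neg_on_interior[OF surj]) (meson interior_mono subsetD)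
      then obtain r where r: "r > 0" "ball x r \<subseteq> V"
        "\<And>y. y \<in> ball x r \<Longrightarrow> total_deriv (g i) y v < 0"
        using total_deriv_nbhd[OF V(1,2)] V(3) unfolding C11_on_def by metis
      have dec: "g i (y + s *\<^sub>R v) < g i y + s * 0"
        if "y \<in> ball x r" "s > 0" "y + s *\<^sub>R v \<in> ball x r" for y s
        by (rule line_increment_less[of "ball x r"]) (use that r V(3) in \<open>auto simp: C11_on_def\<close>)
      then show ?thesis
        using r(1) unfolding P_def by (intro exI[of _ r] conjI ballI allI impI) (fastforce dest: dec)+
    qed
  next
    fix i r r' assume "P i r" "0 < r'" "r' \<le> r"
    then show "P i r'"
      using subset_ball[of r' r x] unfolding P_def by blast
  qed auto
  then obtain r where r: "r > 0" "\<And>i. i \<in> {1..m} \<Longrightarrow> P i r"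
    by blast
  obtain r' where r': "r' > 0" "ball x r' \<subseteq> U"
    using U \<open>x \<in> U\<close> open_contains_ball by blast
  show ?thesis
  proof (intro exI[of _ "min r r'"] conjI ballI allI impI)
    fix y s assume y: "y \<in> feasible_set U m g \<inter> ball x (min r r')" "0 < s"
      "y + s *\<^sub>R v \<in> ball x (min r r')"
    show "y + s *\<^sub>R v \<in> interior (feasible_set U m g)"
    proof (rule strictly_feasible_interior[OF U cont])
      show "y + s *\<^sub>R v \<in> U"
        using y r' by auto
      show "g i (y + s *\<^sub>R v) < 0" if "i \<in> {1..m}" for i
        using r(2)[OF that] y that by (auto simp: P_def feasible_set_def)
    qed auto
  qed (use r r' in auto)
qed

text \<open>At a touching point \<open>z\<close> of a concave arc, every active constraint has zero derivative along the
  tangent \<open>h\<close>. So \<open>h\<close> lies in the linearized cone and in the kernel of every active derivative.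
  Whichever active constraint satisfies the second order condition, the condition thus applies to
  \<open>h\<close> and contradicts the concavity of the arc.\<close>

lemma feasible_set_convex:
  fixes g :: "nat \<Rightarrow> 'a::euclidean_space \<Rightarrow> real"
  assumes U: "open U" and cont: "\<And>i. i \<in> {1..m} \<Longrightarrow> continuous_on U (g i)"
    and C11: "\<And>i. i \<in> {1..m} \<Longrightarrow> C11_submersion_on_zeros U (g i)"
    and closed: "closed (feasible_set U m g)" and conn: "connected (feasible_set U m g)"
    and cond: "\<And>x. x \<in> frontier (feasible_set U m g) \<Longrightarrow>
      interior (linearized_cone m g x) \<noteq> {} \<and>
      (\<exists>i\<in>active_set m g x.
        \<forall>h\<in>linearized_cone m g x \<inter> deriv_kernel (g i) x. second_order_cond (g i) x h)"
  shows "convex (feasible_set U m g)"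
proof (rule convex_if_interior_segments_transitive[OF closed conn])
  let ?\<Omega> = "feasible_set U m g"
  have frontier_sub: "frontier ?\<Omega> \<subseteq> ?\<Omega>"
    using closed by (rule frontier_subset_closed)
  show "\<exists>v. \<exists>r>0. \<forall>y\<in>?\<Omega> \<inter> ball x r. \<forall>s>0. y + s *\<^sub>R v \<in> ball x r \<longrightarrow> y + s *\<^sub>R v \<in> interior ?\<Omega>"
    if x: "x \<in> frontier ?\<Omega>" for x
  proof -
    obtain v where v: "v \<in> interior (linearized_cone m g x)"
      using cond[OF x] by blast
    have "x \<in> ?\<Omega>"
      using x frontier_sub by blast
    show ?thesis
      using feasible_push[OF U cont C11 \<open>x \<in> ?\<Omega>\<close> v] by blast
  qed
  show "closed_segment a c \<subseteq> interior ?\<Omega>"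
    if ab: "closed_segment a b \<subseteq> interior ?\<Omega>" and bc: "closed_segment b c \<subseteq> interior ?\<Omega>" for a b c
  proof (rule ccontr)
    assume "\<not> closed_segment a c \<subseteq> interior ?\<Omega>"
    from concave_touching_point[OF open_interior ab bc this] obtain z p h u \<delta>
      where z: "z \<notin> interior ?\<Omega>" and ball: "ball p (dist p z) \<subseteq> interior ?\<Omega>"
        and u: "0 < (p - z) \<bullet> u" and "\<delta> > 0"
        and arc: "\<And>t. t \<noteq> 0 \<Longrightarrow> \<bar>t\<bar> < \<delta> \<Longrightarrow> z + t *\<^sub>R h - t\<^sup>2 *\<^sub>R u \<in> interior ?\<Omega>"
      by metis
    have "p \<noteq> z"
      using u by auto
    have "z \<in> closure (ball p (dist p z))"
      using \<open>p \<noteq> z\<close> by simp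
    also have "\<dots> \<subseteq> ?\<Omega>"
      using ball interior_subset closed by (metis closure_minimal subset_trans)
    finally have "z \<in> ?\<Omega>" .
    then have "z \<in> frontier ?\<Omega>" "z \<in> U"
      using z closure_subset[of ?\<Omega>] by (auto simp: frontier_def feasible_set_def)
    have active_U: "j \<in> {1..m}" "g j z = 0" if "j \<in> active_set m g z" for j
      using that by (auto simp: active_set_def)
    have active: "\<exists>V. open V \<and> z \<in> V \<and> C11_on V (g j)" "surj (blinfun_apply (total_deriv (g j) z))"
      if "j \<in> active_set m g z" for j
      using C11_submersion_at_zero[OF C11[OF active_U(1)[OF that]] \<open>z \<in> U\<close> active_U(2)[OF that]]
      by metis+
    have diff: "g j differentiable (at z)" if "j \<in> active_set m g z" for j
      using active(1)[OF that] by (auto simp: C11_on_def)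
    have le: "g j y \<le> g j z" if "j \<in> active_set m g z" "y \<in> ?\<Omega>" for j y
      using that by (auto simp: active_set_def feasible_set_def)
    have arc_le: "g j (z + t *\<^sub>R h - t\<^sup>2 *\<^sub>R u) \<le> g j z" if "j \<in> active_set m g z" "\<bar>t\<bar> < \<delta>" for j t
      using le[OF that(1)] arc[OF _ that(2)] interior_subset[of ?\<Omega>] by (cases "t = 0") auto
    have h: "total_deriv (g j) z h = 0" if "j \<in> active_set m g z" for j
      using total_deriv_zero_along_arc[OF diff[OF that] \<open>\<delta> > 0\<close> arc_le[OF that]] .
    obtain i where i: "i \<in> active_set m g z"
      and soc: "\<forall>h\<in>linearized_cone m g z \<inter> deriv_kernel (g i) z. second_order_cond (g i) z h"
      using cond[OF \<open>z \<in> frontier ?\<Omega>\<close>] by blast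
    obtain V where V: "open V" "z \<in> V" "C11_on V (g i)"
      using active(1)[OF i] by blast
    have "total_deriv (g i) z u < 0"
      by (rule total_deriv_neg_into_ball[OF diff[OF i] active(2)[OF i] _ u])
        (use le[OF i] ball interior_subset[of ?\<Omega>] in blast)
    then have "\<not> second_order_cond (g i) z h"
      using V by (intro not_second_order_cond_on_concave_arc[OF V(1,2) _ _ _ \<open>\<delta> > 0\<close> arc_le[OF i]])
        (auto simp: C11_on_def)
    moreover have "second_order_cond (g i) z h"
      using soc h i by (auto simp: linearized_cone_def deriv_kernel_def)
    ultimately show False
      by blast
  qed
qed

section \<open>Curves along one active constraint inside the feasible set\<close>

text \<open>Represent the functionals by vectors; the component of the \<open>i\<close>-th vector orthogonal to the span
  of the others is nonzero by independence, and can be normalised.\<close>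

lemma independent_family_dual_vector:
  fixes \<phi> :: "'i \<Rightarrow> 'a::euclidean_space \<Rightarrow>\<^sub>L real"
  assumes indep: "independent_family I \<phi>" and i: "i \<in> I"
  shows "\<exists>v. \<phi> i v = 1 \<and> (\<forall>j\<in>I - {i}. \<phi> j v = 0)"
proof -
  define a where "a j = adjoint (\<phi> j) 1" for j
  have a: "\<phi> j x = x \<bullet> a j" for j x
    using adjoint_works[of "\<phi> j" x 1] by (simp add: a_def bounded_linear.linear[OF blinfun.bounded_linear_right])
  have \<phi>_a: "\<phi> j = blinfun_inner_left (a j)" for j
    by (rule blinfun_eqI) (simp add: a inner_commute)
  have "a i \<notin> span (a ` (I - {i}))"
  proof
    assume "a i \<in> span (a ` (I - {i}))"
    then have "\<phi> i \<in> span (blinfun_inner_left ` a ` (I - {i}))"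
      unfolding \<phi>_a[of i]
      using linear_span_image[OF bounded_linear.linear[OF bounded_linear_blinfun_inner_left]] by blast
    also have "blinfun_inner_left ` a ` (I - {i}) = \<phi> ` (I - {i})"
      by (auto simp: \<phi>_a image_image)
    also have "\<dots> = \<phi> ` I - {\<phi> i}"
      using indep i by (auto simp: independent_family_def inj_on_def)
    finally show False
      using indep i by (auto simp: independent_family_def dependent_def)
  qed
  obtain y n where yn: "y \<in> span (a ` (I - {i}))" "\<And>w. w \<in> span (a ` (I - {i})) \<Longrightarrow> orthogonal n w"
    "a i = y + n"
    using orthogonal_subspace_decomp_exists[of "a ` (I - {i})" "a i"] by metis
  have "n \<noteq> 0"
    using yn \<open>a i \<notin> span (a ` (I - {i}))\<close> by auto
  have "n \<bullet> a i = n \<bullet> n"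
    using yn(2)[OF yn(1)] by (simp add: yn(3) inner_add_right orthogonal_def)
  then have "\<phi> i (n /\<^sub>R (n \<bullet> n)) = 1"
    using \<open>n \<noteq> 0\<close> by (simp add: a)
  moreover have "\<phi> j (n /\<^sub>R (n \<bullet> n)) = 0" if "j \<in> I - {i}" for j
    using yn(2)[of "a j"] that by (simp add: a orthogonal_def span_base)
  ultimately show ?thesis
    by blast
qed

lemma independent_family_interpolation:
  fixes \<phi> :: "'i \<Rightarrow> 'a::euclidean_space \<Rightarrow>\<^sub>L real"
  assumes "finite I" and indep: "independent_family I \<phi>"
  obtains v where "\<And>j. j \<in> I \<Longrightarrow> \<phi> j v = c j"
proof -
  obtain d where d: "\<And>i. i \<in> I \<Longrightarrow> \<phi> i (d i) = 1 \<and> (\<forall>j\<in>I - {i}. \<phi> j (d i) = 0)"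
    using independent_family_dual_vector[OF indep] by metis
  have "\<phi> j (\<Sum>i\<in>I. c i *\<^sub>R d i) = c j" if "j \<in> I" for j
  proof -
    have "\<phi> j (\<Sum>i\<in>I. c i *\<^sub>R d i) = (\<Sum>i\<in>I. c i * \<phi> j (d i))"
      by (simp add: blinfun.sum_right blinfun.scaleR_right)
    also have "\<dots> = (\<Sum>i\<in>I. if i = j then c j else 0)"
      using d that by (intro sum.cong) auto
    also have "\<dots> = c j"
      using \<open>finite I\<close> that by simp
    finally show ?thesis .
  qed
  then show thesis
    by (rule that)
qed

lemma lipschitz_total_deriv_remainder:
  fixes f :: "'a::real_normed_vector \<Rightarrow> real"
  assumes diff: "\<And>y. y \<in> ball x r \<Longrightarrow> f differentiable (at y)"
    and lip: "L-lipschitz_on (ball x r) (total_deriv f)" and d: "norm d < r"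
  shows "\<bar>f (x + d) - f x - total_deriv f x d\<bar> \<le> L * (norm d)\<^sup>2"
proof -
  define S where "S = closed_segment x (x + d)"
  have S: "y \<in> ball x r \<and> dist y x \<le> norm d" if y: "y \<in> S" for y
  proof -
    obtain t where t: "0 \<le> t" "t \<le> 1" "y = x + t *\<^sub>R d"
      using y by (auto simp: S_def closed_segment_def algebra_simps)
    have "t * norm d \<le> 1 * norm d"
      using t by (intro mult_right_mono) auto
    moreover have "dist y x = t * norm d"
      using t by (simp add: dist_norm)
    ultimately show ?thesis
      using d by (simp add: dist_commute)
  qed
  have "r > 0"
    using d norm_ge_zero[of d] by linarith
  have "L \<ge> 0"
    using lip by (rule lipschitz_on_nonneg)
  have "norm (f (x + d) - f x - total_deriv f x ((x + d) - x)) \<le> norm ((x + d) - x) * (L * norm d)"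
  proof (rule differentiable_bound_linearization[where S = S])
    show "x + t *\<^sub>R (x + d - x) \<in> S" if "t \<in> {0..1}" for t
      using that by (auto simp: S_def closed_segment_def algebra_simps intro!: exI[of _ t])
    show "(f has_derivative total_deriv f y) (at y within S)" if "y \<in> S" for y
      using S[OF that] diff has_derivative_total_deriv has_derivative_at_withinI by blast
    show "onorm (blinfun_apply (total_deriv f y) - blinfun_apply (total_deriv f x)) \<le> L * norm d" if "y \<in> S" for y
    proof -
      have "norm (total_deriv f y - total_deriv f x) \<le> L * dist y x"
        using lipschitz_onD[OF lip, of y x] S[OF that] \<open>r > 0\<close> by (simp add: dist_norm)
      also have "\<dots> \<le> L * norm d"
        using S[OF that] \<open>L \<ge> 0\<close> by (intro mult_left_mono) auto
      finally show ?thesis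
        by (simp add: norm_blinfun.rep_eq minus_blinfun.rep_eq fun_diff_def)
    qed
    show "x \<in> S"
      by (simp add: S_def)
  qed
  then show ?thesis
    by (simp add: power2_eq_square mult.commute mult.left_commute)
qed

lemma total_deriv_supporting:
  fixes f :: "'a::real_normed_vector \<Rightarrow> real"
  assumes "convex \<Omega>" "y \<in> \<Omega>" "w \<in> \<Omega>" and diff: "f differentiable (at y)"
    and le: "\<And>x. x \<in> \<Omega> \<Longrightarrow> f x \<le> f y"
  shows "total_deriv f y (w - y) \<le> 0"
proof (rule total_deriv_nonpos_if_nonincreasing[OF diff])
  have "\<forall>\<^sub>F t in at_right (0::real). 0 < t \<and> t < 1"
    unfolding eventually_at_right_field by (intro exI[of _ 1]) auto
  then show "\<forall>\<^sub>F t in at_right 0. f (y + t *\<^sub>R (w - y)) \<le> f y"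
  proof eventually_elim
    case (elim t)
    have "(1 - t) *\<^sub>R y + t *\<^sub>R w \<in> \<Omega>"
      using assms(1-3) elim by (intro convexD) auto
    then show ?case
      by (intro le) (simp add: algebra_simps)
  qed
qed

text \<open>Let \<open>y = x + t h + t\<^sup>2 k\<close> be a zero of \<open>f\<close> in a convex set on which \<open>f \<le> 0\<close>. The
  hyperplane supporting the set at \<open>x\<close> gives \<open>f' x k \<le> 0\<close>, and the one at \<open>y\<close> gives
  \<open>f' y (t h + t\<^sup>2 k) \<ge> 0\<close>. The three points \<open>x\<close>, \<open>x + t h\<close> and \<open>y\<close> are so close that a
  Lipschitz derivative may be evaluated at \<open>x + t h\<close> in both inequalities with a total error
  \<open>O(t\<^sup>3)\<close>. Their combination bounds \<open>t f' (x + t h) h\<close> from below by \<open>- O(t\<^sup>3)\<close>.\<close>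

lemma slope_bound_from_supporting:
  fixes f :: "'a::real_normed_vector \<Rightarrow> real"
  assumes lip: "L-lipschitz_on B (total_deriv f)"
    and B: "x \<in> B" "x + t *\<^sub>R h \<in> B" "x + t *\<^sub>R h + t\<^sup>2 *\<^sub>R k \<in> B"
    and t: "t > 0" "norm (t *\<^sub>R h + t\<^sup>2 *\<^sub>R k) \<le> t * \<rho>" and h: "total_deriv f x h = 0"
    and at_x: "total_deriv f x (t *\<^sub>R h + t\<^sup>2 *\<^sub>R k) \<le> 0"
    and at_y: "total_deriv f (x + t *\<^sub>R h + t\<^sup>2 *\<^sub>R k) (t *\<^sub>R h + t\<^sup>2 *\<^sub>R k) \<ge> 0"
  shows "- t * (L * norm k * (\<rho> + norm h)) \<le> total_deriv f (x + t *\<^sub>R h) h / t"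
proof -
  define d where "d = t *\<^sub>R h + t\<^sup>2 *\<^sub>R k"
  define A where "A y = blinfun_apply (total_deriv f y)" for y
  have "L \<ge> 0"
    using lip by (rule lipschitz_on_nonneg)
  have lip': "\<bar>A y v - A w v\<bar> \<le> L * dist y w * norm v" if "y \<in> B" "w \<in> B" for y w v
  proof -
    have "\<bar>A y v - A w v\<bar> \<le> norm (total_deriv f y - total_deriv f w) * norm v"
      using norm_blinfun[of "total_deriv f y - total_deriv f w" v] by (simp add: A_def blinfun.diff_left)
    also have "\<dots> \<le> L * dist y w * norm v"
      using lipschitz_onD[OF lip that] by (intro mult_right_mono) (auto simp: dist_norm)
    finally show ?thesis .
  qed
  have "A x k \<le> 0"
  proof -
    have "A x d = t\<^sup>2 * A x k"
      using h by (simp add: A_def d_def blinfun.add_right blinfun.scaleR_right)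
    then show ?thesis
      using at_x t(1) unfolding d_def[symmetric] A_def by (simp add: mult_le_0_iff)
  qed
  moreover have "\<bar>A (x + t *\<^sub>R h) k - A x k\<bar> \<le> L * (t * norm h) * norm k"
    using lip'[OF B(2,1), of k] t(1) by (simp add: dist_norm)
  ultimately have k_le: "A (x + t *\<^sub>R h) k \<le> L * (t * norm h) * norm k"
    by linarith
  have "A (x + d) d \<ge> 0"
    using at_y by (simp add: A_def d_def add.assoc)
  moreover have "\<bar>A (x + t *\<^sub>R h) d - A (x + d) d\<bar> \<le> L * (t\<^sup>2 * norm k) * norm d"
    using lip'[OF B(2,3), of d] by (simp add: dist_norm d_def add.assoc)
  moreover have "L * (t\<^sup>2 * norm k) * norm d \<le> L * (t\<^sup>2 * norm k) * (t * \<rho>)"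
    using t \<open>L \<ge> 0\<close> by (intro mult_left_mono) (auto simp: d_def)
  ultimately have "- (L * (t\<^sup>2 * norm k) * (t * \<rho>)) \<le> A (x + t *\<^sub>R h) d"
    by linarith
  also have "\<dots> = t * A (x + t *\<^sub>R h) h + t\<^sup>2 * A (x + t *\<^sub>R h) k"
    by (simp add: A_def d_def blinfun.add_right blinfun.scaleR_right)
  also have "\<dots> \<le> t * A (x + t *\<^sub>R h) h + t\<^sup>2 * (L * (t * norm h) * norm k)"
    using k_le by (simp add: mult_left_mono)
  finally have "t\<^sup>2 * (- t * (L * norm k * (\<rho> + norm h))) \<le> t\<^sup>2 * (A (x + t *\<^sub>R h) h / t)"
    using t(1) by (simp add: field_simps power2_eq_square)
  then have "- t * (L * norm k * (\<rho> + norm h)) \<le> A (x + t *\<^sub>R h) h / t"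
    by (rule mult_left_le_imp_le) (use t(1) in simp)
  then show ?thesis
    by (simp add: A_def)
qed

lemma second_order_condI:
  assumes "\<epsilon> > 0" and bound: "\<And>t. 0 < t \<Longrightarrow> t < \<epsilon> \<Longrightarrow> - t * C \<le> total_deriv f (x + t *\<^sub>R h) h / t"
  shows "second_order_cond f x h"
proof -
  have "((\<lambda>t. ereal (- t * C)) \<longlongrightarrow> ereal (- 0 * C)) (at_right 0)"
    by (intro tendsto_intros)
  then have "Liminf (at_right 0) (\<lambda>t. ereal (- t * C)) = 0"
    by (intro lim_imp_Liminf) (auto simp: zero_ereal_def)
  moreover have "Liminf (at_right 0) (\<lambda>t. ereal (- t * C)) \<le>
      Liminf (at_right 0) (\<lambda>t. ereal (total_deriv f (x + t *\<^sub>R h) h / t))"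
  proof (rule Liminf_mono)
    show "\<forall>\<^sub>F t in at_right 0. ereal (- t * C) \<le> ereal (total_deriv f (x + t *\<^sub>R h) h / t)"
      unfolding eventually_at_right_field using \<open>\<epsilon> > 0\<close> bound by (intro exI[of _ \<epsilon>]) auto
  qed
  ultimately show ?thesis
    unfolding second_order_cond_def by simp
qed

text \<open>One radius and one Lipschitz constant serve all of the finitely many constraints.\<close>

lemma active_constraint_expansions:
  fixes g :: "nat \<Rightarrow> 'a::real_normed_vector \<Rightarrow> real"
  assumes U: "open U" and cont: "\<And>i. i \<in> {1..m} \<Longrightarrow> continuous_on U (g i)"
    and C11: "\<And>i. i \<in> {1..m} \<Longrightarrow> C11_submersion_on_zeros U (g i)"
    and x: "x \<in> feasible_set U m g"
  obtains r L where "r > 0" "L \<ge> 0" "ball x r \<subseteq> U"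
    "\<And>j d. j \<in> {1..m} - active_set m g x \<Longrightarrow> norm d < r \<Longrightarrow> g j (x + d) < 0"
    "\<And>j d. j \<in> active_set m g x \<Longrightarrow> norm d < r \<Longrightarrow>
      \<bar>g j (x + d) - total_deriv (g j) x d\<bar> \<le> L * (norm d)\<^sup>2"
    "\<And>j y. j \<in> active_set m g x \<Longrightarrow> y \<in> ball x r \<Longrightarrow> g j differentiable (at y)"
    "\<And>j. j \<in> active_set m g x \<Longrightarrow> L-lipschitz_on (ball x r) (total_deriv (g j))"
proof -
  let ?A = "active_set m g x"
  have "x \<in> U"
    using x by (simp add: feasible_set_def)
  have "\<exists>V L. open V \<and> x \<in> V \<and> (\<forall>y\<in>V. g j differentiable (at y)) \<and> L-lipschitz_on V (total_deriv (g j))"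
    if "j \<in> ?A" for j
  proof -
    have "j \<in> {1..m}" "g j x = 0"
      using that by (auto simp: active_set_def)
    from C11_submersion_at_zero[OF C11[OF this(1)] \<open>x \<in> U\<close> this(2)] show ?thesis
      unfolding C11_on_def by metis
  qed
  then obtain V \<Lambda> where V: "\<And>j. j \<in> ?A \<Longrightarrow> open (V j)" "\<And>j. j \<in> ?A \<Longrightarrow> x \<in> V j"
    "\<And>j y. j \<in> ?A \<Longrightarrow> y \<in> V j \<Longrightarrow> g j differentiable (at y)"
    "\<And>j. j \<in> ?A \<Longrightarrow> (\<Lambda> j)-lipschitz_on (V j) (total_deriv (g j))"
    by metis
  have "finite ?A"
    by (simp add: active_set_def)
  define L where "L = Max (insert 0 (\<Lambda> ` ?A))"
  have L: "L \<ge> 0" "\<And>j. j \<in> ?A \<Longrightarrow> \<Lambda> j \<le> L"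
    using \<open>finite ?A\<close> by (auto simp: L_def)
  define P where "P j r \<longleftrightarrow> (if j \<in> ?A then ball x r \<subseteq> V j \<inter> U else \<forall>y\<in>ball x r. y \<in> U \<and> g j y < 0)" for j r
  have "\<exists>r>0. \<forall>j\<in>{1..m}. P j r"
  proof (rule common_radius)
    fix j assume j: "j \<in> {1..m}"
    show "\<exists>r>0. P j r"
    proof (cases "j \<in> ?A")
      case True
      have "open (V j \<inter> U)" "x \<in> V j \<inter> U"
        using V(1,2)[OF True] U \<open>x \<in> U\<close> by auto
      then show ?thesis
        using True unfolding P_def by (simp only: if_True) (meson open_contains_ball)
    next
      case False
      then have "g j x < 0"
        using j x by (force simp: active_set_def feasible_set_def)
      then show ?thesis
        using False inactive_constraint_nbhd[OF U cont[OF j] \<open>x \<in> U\<close>] unfolding P_def by simp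
    qed
  next
    fix j r r' assume "P j r" "0 < r'" "r' \<le> r"
    then show "P j r'"
      using subset_ball[of r' r x] unfolding P_def by (meson subsetD subset_trans)
  qed auto
  then obtain r0 where r0: "r0 > 0" "\<And>j. j \<in> {1..m} \<Longrightarrow> P j r0"
    by blast
  obtain r1 where r1: "r1 > 0" "ball x r1 \<subseteq> U"
    using U \<open>x \<in> U\<close> open_contains_ball by blast
  define r where "r = min r0 r1"
  have r: "r > 0" "ball x r \<subseteq> ball x r0" "ball x r \<subseteq> ball x r1"
    using r0 r1 by (auto simp: r_def)
  have A: "ball x r \<subseteq> V j" if "j \<in> ?A" for j
    using r0(2)[of j] that r(2) by (auto simp: P_def active_set_def)
  have diff: "g j differentiable (at y)" if "j \<in> ?A" "y \<in> ball x r" for j y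
    using V(3) A that by blast
  have lip: "L-lipschitz_on (ball x r) (total_deriv (g j))" if "j \<in> ?A" for j
    using V(4)[OF that] A[OF that] L(2)[OF that] by (meson lipschitz_on_mono)
  show thesis
  proof (rule that[OF \<open>r > 0\<close> L(1)])
    show "ball x r \<subseteq> U"
      using r(3) r1(2) by blast
    show "g j (x + d) < 0" if "j \<in> {1..m} - ?A" "norm d < r" for j d
    proof -
      have "x + d \<in> ball x r0"
        using that(2) r(2) by (auto simp: dist_norm r_def)
      then show ?thesis
        using r0(2)[of j] that(1) by (simp add: P_def)
    qed
    show "\<bar>g j (x + d) - total_deriv (g j) x d\<bar> \<le> L * (norm d)\<^sup>2" if "j \<in> ?A" "norm d < r" for j d
      using lipschitz_total_deriv_remainder[OF diff[OF that(1)] lip[OF that(1)] that(2)] that(1)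
      by (simp add: active_set_def)
  qed (use diff lip in auto)
qed

text \<open>Linear independence supplies a correction \<open>v\<close> that decreases the other active constraints and is
  neutral for \<open>g i\<close>, and a direction \<open>n\<close> that moves \<open>g i\<close> alone. The curve
  \<open>x + t h + t\<^sup>2 K (v + \<sigma> n)\<close> is then feasible for the constraints other than \<open>g i\<close>, and the
  intermediate value theorem in \<open>\<sigma>\<close> puts it on the zero set of \<open>g i\<close>. Convexity enters
  through the supporting hyperplanes at \<open>x\<close> and at that point of the curve.\<close>

lemma convex_feasible_set_second_order_cond:
  fixes g :: "nat \<Rightarrow> 'a::euclidean_space \<Rightarrow> real"
  assumes U: "open U" and cont: "\<And>i. i \<in> {1..m} \<Longrightarrow> continuous_on U (g i)"
    and C11: "\<And>i. i \<in> {1..m} \<Longrightarrow> C11_submersion_on_zeros U (g i)"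
    and conv: "convex (feasible_set U m g)" and x: "x \<in> feasible_set U m g"
    and indep: "independent_family (active_set m g x) (\<lambda>i. total_deriv (g i) x)"
    and i: "i \<in> active_set m g x" and h: "h \<in> linearized_cone m g x" "h \<in> deriv_kernel (g i) x"
  shows "second_order_cond (g i) x h"
proof -
  let ?A = "active_set m g x" and ?\<Omega> = "feasible_set U m g"
  obtain r L where r: "r > 0" "ball x r \<subseteq> U" and "L \<ge> 0"
    and inactive: "\<And>j d. j \<in> {1..m} - ?A \<Longrightarrow> norm d < r \<Longrightarrow> g j (x + d) < 0"
    and remainder: "\<And>j d. j \<in> ?A \<Longrightarrow> norm d < r \<Longrightarrow>
      \<bar>g j (x + d) - total_deriv (g j) x d\<bar> \<le> L * (norm d)\<^sup>2"
    and diff: "\<And>j y. j \<in> ?A \<Longrightarrow> y \<in> ball x r \<Longrightarrow> g j differentiable (at y)"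
    and lip: "\<And>j. j \<in> ?A \<Longrightarrow> L-lipschitz_on (ball x r) (total_deriv (g j))"
    using active_constraint_expansions[OF U cont C11 x] by metis
  have "finite ?A" "i \<in> {1..m}"
    using i by (auto simp: active_set_def)
  obtain v where v: "\<And>j. j \<in> ?A \<Longrightarrow> total_deriv (g j) x v = (if j = i then 0 else -1)"
    using independent_family_interpolation[OF \<open>finite ?A\<close> indep, where c = "\<lambda>j. if j = i then 0 else -1"]
    by blast
  obtain n where n: "\<And>j. j \<in> ?A \<Longrightarrow> total_deriv (g j) x n = (if j = i then 1 else 0)"
    using independent_family_interpolation[OF \<open>finite ?A\<close> indep, where c = "\<lambda>j. if j = i then 1 else 0"]
    by blast
  \<comment> \<open>The displacements \<open>d\<close> along the curve have norm at most \<open>t \<rho>\<close>, so all remainders are at most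
    \<open>L \<rho>\<^sup>2 t\<^sup>2\<close>. The factor \<open>K\<close> makes the first order effect of the correction exceed this.\<close>
  define \<rho> where "\<rho> = norm h + 1"
  define K where "K = L * \<rho>\<^sup>2 + 1"
  have "K > 0" "\<rho> > 0"
    using \<open>L \<ge> 0\<close> by (auto simp: K_def \<rho>_def add_nonneg_pos)
  define k where "k \<sigma> = K *\<^sub>R (v + \<sigma> *\<^sub>R n)" for \<sigma> :: real
  define N where "N = K * (norm v + norm n) + 1"
  have "N > 0"
    using \<open>K > 0\<close> by (simp add: N_def add_nonneg_pos)
  have k_le: "norm (k \<sigma>) \<le> N" if "\<bar>\<sigma>\<bar> \<le> 1" for \<sigma>
  proof -
    have "norm (v + \<sigma> *\<^sub>R n) \<le> norm v + \<bar>\<sigma>\<bar> * norm n"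
      using norm_triangle_ineq[of v "\<sigma> *\<^sub>R n"] by simp
    also have "\<dots> \<le> norm v + 1 * norm n"
      using that by (intro add_left_mono mult_right_mono) auto
    finally have "K * norm (v + \<sigma> *\<^sub>R n) \<le> K * (norm v + norm n)"
      using \<open>K > 0\<close> by simp
    moreover have "norm (k \<sigma>) = K * norm (v + \<sigma> *\<^sub>R n)"
      using \<open>K > 0\<close> by (simp add: k_def)
    ultimately show ?thesis
      unfolding N_def by linarith
  qed
  define \<epsilon> where "\<epsilon> = min (1 / N) (r / \<rho>)"
  have "\<epsilon> > 0"
    using \<open>N > 0\<close> \<open>\<rho> > 0\<close> r(1) by (simp add: \<epsilon>_def)
  show ?thesis
  proof (rule second_order_condI[OF \<open>\<epsilon> > 0\<close>])
    fix t assume t: "0 < t" "t < \<epsilon>"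
    have "t * N < 1" "t * \<rho> < r"
      using t \<open>N > 0\<close> \<open>\<rho> > 0\<close> by (auto simp: \<epsilon>_def field_simps)
    define d where "d \<sigma> = t *\<^sub>R h + t\<^sup>2 *\<^sub>R k \<sigma>" for \<sigma>
    have norm_d: "norm (d \<sigma>) \<le> t * \<rho>" if "\<bar>\<sigma>\<bar> \<le> 1" for \<sigma>
    proof -
      have "t * norm (k \<sigma>) \<le> t * N"
        using k_le[OF that] t by simp
      then have "t * norm (k \<sigma>) \<le> 1"
        using \<open>t * N < 1\<close> by linarith
      then have "t * (t * norm (k \<sigma>)) \<le> t * 1"
        using t by (intro mult_left_mono) auto
      moreover have "norm (d \<sigma>) \<le> t * norm h + t\<^sup>2 * norm (k \<sigma>)"
        unfolding d_def using norm_triangle_ineq[of "t *\<^sub>R h" "t\<^sup>2 *\<^sub>R k \<sigma>"] t by simp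
      ultimately show ?thesis
        by (simp add: \<rho>_def algebra_simps power2_eq_square)
    qed
    then have in_ball: "norm (d \<sigma>) < r" if "\<bar>\<sigma>\<bar> \<le> 1" for \<sigma>
      using that \<open>t * \<rho> < r\<close> by fastforce
    have rem: "\<bar>g j (x + d \<sigma>) - total_deriv (g j) x (d \<sigma>)\<bar> \<le> t\<^sup>2 * (K - 1)"
      if "j \<in> ?A" "\<bar>\<sigma>\<bar> \<le> 1" for j \<sigma>
    proof -
      have "(norm (d \<sigma>))\<^sup>2 \<le> (t * \<rho>)\<^sup>2"
        using norm_d[OF that(2)] by (intro power_mono) auto
      then have "L * (norm (d \<sigma>))\<^sup>2 \<le> L * (t * \<rho>)\<^sup>2"
        using \<open>L \<ge> 0\<close> by (rule mult_left_mono)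
      then show ?thesis
        using remainder[OF that(1) in_ball[OF that(2)]] by (simp add: K_def power_mult_distrib algebra_simps)
    qed
    have lin_i: "total_deriv (g i) x (d \<sigma>) = t\<^sup>2 * (K * \<sigma>)" for \<sigma>
      using h(2) v[OF i] n[OF i]
      by (simp add: d_def k_def deriv_kernel_def blinfun.add_right blinfun.scaleR_right)
    have lin_j: "total_deriv (g j) x (d \<sigma>) \<le> - (t\<^sup>2 * K)" if "j \<in> ?A" "j \<noteq> i" for j \<sigma>
    proof -
      have "total_deriv (g j) x (d \<sigma>) = t * total_deriv (g j) x h - t\<^sup>2 * K"
        using v[OF that(1)] n[OF that(1)] that(2)
        by (simp add: d_def k_def blinfun.add_right blinfun.scaleR_right)
      moreover have "t * total_deriv (g j) x h \<le> 0"
        using h(1) that(1) t by (intro mult_nonneg_nonpos) (auto simp: linearized_cone_def)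
      ultimately show ?thesis
        by simp
    qed
    have "continuous_on {-1..1} (\<lambda>\<sigma>. g i (x + d \<sigma>))"
    proof (rule continuous_on_compose2[OF cont[OF \<open>i \<in> {1..m}\<close>]])
      show "continuous_on {-1..1} (\<lambda>\<sigma>. x + d \<sigma>)"
        unfolding d_def k_def by (intro continuous_intros)
      show "(\<lambda>\<sigma>. x + d \<sigma>) ` {-1..1} \<subseteq> U"
        using in_ball r(2) by (force simp: dist_norm abs_le_iff)
    qed
    moreover have "g i (x + d (-1)) \<le> 0"
      using rem[OF i, of "-1"] lin_i[of "-1"] t by (simp add: algebra_simps) (smt (verit) zero_le_power2)
    moreover have "0 \<le> g i (x + d 1)"
      using rem[OF i, of 1] lin_i[of 1] t by (simp add: algebra_simps) (smt (verit) zero_le_power2)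
    ultimately obtain \<sigma> where \<sigma>: "-1 \<le> \<sigma>" "\<sigma> \<le> 1" and zero: "g i (x + d \<sigma>) = 0"
      using IVT'[of "\<lambda>\<sigma>. g i (x + d \<sigma>)" "-1" 0 1] by auto
    have "\<bar>\<sigma>\<bar> \<le> 1"
      using \<sigma> by simp
    have y_ball: "x + d \<sigma> \<in> ball x r"
      using in_ball[OF \<open>\<bar>\<sigma>\<bar> \<le> 1\<close>] by (simp add: dist_norm)
    have y: "x + d \<sigma> \<in> ?\<Omega>"
    proof -
      have "g j (x + d \<sigma>) \<le> 0" if "j \<in> {1..m}" for j
      proof -
        consider "j \<notin> ?A" | "j = i" | "j \<in> ?A" "j \<noteq> i"
          by blast
        then show ?thesis
        proof cases
          case 1
          then show ?thesis
            using inactive[of j "d \<sigma>"] that in_ball[OF \<open>\<bar>\<sigma>\<bar> \<le> 1\<close>] by simp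
        next
          case 2
          then show ?thesis
            using zero by simp
        next
          case 3
          then show ?thesis
            using rem[OF 3(1) \<open>\<bar>\<sigma>\<bar> \<le> 1\<close>] lin_j[OF 3, of \<sigma>]
            by (simp add: algebra_simps) (smt (verit) zero_le_power2)
        qed
      qed
      then show ?thesis
        using y_ball r(2) by (auto simp: feasible_set_def)
    qed
    have g_le: "g i w \<le> 0" if "w \<in> ?\<Omega>" for w
      using that \<open>i \<in> {1..m}\<close> by (simp add: feasible_set_def)
    have at_x: "total_deriv (g i) x (d \<sigma>) \<le> 0"
      using total_deriv_supporting[OF conv x y diff[OF i]] r(1) g_le i by (simp add: active_set_def)
    have "total_deriv (g i) (x + d \<sigma>) (x - (x + d \<sigma>)) \<le> 0"
      by (rule total_deriv_supporting[OF conv y x diff[OF i y_ball]]) (simp add: zero g_le)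
    then have at_y: "total_deriv (g i) (x + d \<sigma>) (d \<sigma>) \<ge> 0"
      by (simp add: blinfun.minus_right)
    have "t * norm h \<le> t * \<rho>"
      using t by (simp add: \<rho>_def)
    then have "t * norm h < r"
      using \<open>t * \<rho> < r\<close> by linarith
    then have th: "x + t *\<^sub>R h \<in> ball x r"
      using t by (simp add: dist_norm)
    have "- t * (L * norm (k \<sigma>) * (\<rho> + norm h)) \<le> total_deriv (g i) (x + t *\<^sub>R h) h / t"
      by (rule slope_bound_from_supporting[OF lip[OF i]])
        (use r(1) th y_ball t norm_d[OF \<open>\<bar>\<sigma>\<bar> \<le> 1\<close>] h(2) at_x at_y in
          \<open>simp_all add: d_def deriv_kernel_def add.assoc\<close>)
    moreover have "t * (L * norm (k \<sigma>) * (\<rho> + norm h)) \<le> t * (L * N * (\<rho> + norm h))"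
      using k_le[OF \<open>\<bar>\<sigma>\<bar> \<le> 1\<close>] t \<open>L \<ge> 0\<close> \<open>\<rho> > 0\<close> by (intro mult_left_mono mult_right_mono) auto
    ultimately show "- t * (L * N * (\<rho> + norm h)) \<le> total_deriv (g i) (x + t *\<^sub>R h) h / t"
      by simp
  qed
qed

section \<open>Convexity and the second order condition\<close>

theorem theorem3p1:
  fixes U :: "(real ^ 'n) set"
    and m :: nat
    and g :: "nat \<Rightarrow> real ^ 'n \<Rightarrow> real"
  assumes "open U"
    and "m \<ge> 1"
    and "\<And>i. i \<in> {1..m} \<Longrightarrow> continuous_on U (g i)"
    and "\<And>i. i \<in> {1..m} \<Longrightarrow> C11_submersion_on_zeros U (g i)"
    and "closed (feasible_set U m g)"
    and "connected (feasible_set U m g)"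
  shows
    "((\<forall>x\<in>frontier (feasible_set U m g).
         interior (linearized_cone m g x) \<noteq> {} \<and>
         (\<exists>i\<in>active_set m g x.
            \<forall>h\<in>linearized_cone m g x \<inter> deriv_kernel (g i) x. second_order_cond (g i) x h))
      \<longrightarrow> convex (feasible_set U m g))
     \<and>
     (\<forall>x. convex (feasible_set U m g) \<longrightarrow>
         x \<in> frontier (feasible_set U m g) \<longrightarrow>
         independent_family (active_set m g x) (\<lambda>i. total_deriv (g i) x) \<longrightarrow>
         (\<forall>i\<in>active_set m g x.
            \<forall>h\<in>linearized_cone m g x \<inter> deriv_kernel (g i) x. second_order_cond (g i) x h))"
proof (intro conjI allI impI ballI)
  let ?\<Omega> = "feasible_set U m g"
  assume "\<forall>x\<in>frontier ?\<Omega>. interior (linearized_cone m g x) \<noteq> {} \<and>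
    (\<exists>i\<in>active_set m g x.
      \<forall>h\<in>linearized_cone m g x \<inter> deriv_kernel (g i) x. second_order_cond (g i) x h)"
  then show "convex ?\<Omega>"
    by (intro feasible_set_convex[OF assms(1,3-6)]) blast+
next
  let ?\<Omega> = "feasible_set U m g"
  fix x i h
  assume "convex ?\<Omega>" "x \<in> frontier ?\<Omega>"
    and "independent_family (active_set m g x) (\<lambda>i. total_deriv (g i) x)" "i \<in> active_set m g x"
    and "h \<in> linearized_cone m g x \<inter> deriv_kernel (g i) x"
  moreover have "x \<in> ?\<Omega>"
    using \<open>x \<in> frontier ?\<Omega>\<close> frontier_subset_closed[OF assms(5)] by blast
  ultimately show "second_order_cond (g i) x h"
    by (intro convex_feasible_set_second_order_cond[OF assms(1,3,4)]) auto
qed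

end
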